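(* Consider the system $\mathcal S$ (defined in the context) with system mapping $f$ and matrix $B$ satisfying assumptions (1), (2) and (4) of the context and controller mapping $k$ satisfying assumption (3). Let $\rho=\frac{\mu^2}{\mu^2+\sigma^2}$ and $\bar\rho=1-\rho$. Let $\Lambda^k_{exp}>0$, $k=1,\dots,N$, be the positive Lyapunov exponents of the system $x_{n+1}=f(x_n)$, with $\Lambda^1_{exp}$ the maximum one, and let $\lambda^k_{exp}=\exp(\Lambda^k_{exp})$. Let $\lambda_0^k$, $k=1,\dots,N$, be the (unstable) eigenvalues of the Jacobian $\frac{\partial f}{\partial x}(0)$, and $\lambda_{max}$ its eigenvalue of maximum absolute value. Suppose $\mathcal S$ is mean-square exponential incrementally stable. Then: (i) if the number $d$ of control inputs satisfies $1\le d<N$, $$\bar\rho^{\,d}\max\left(\prod_{k=1}^N\left(\lambda^k_{exp}\right)^2,\ \prod_{k=1}^N|\lambda_0^k|^2\right)<1;$$ (ii) in the $N$ input case ($d=N$), $$\bar\rho\,\max\left((\lambda^1_{exp})^2,\ |\lambda_{max}|^2\right)<1.$$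
   Context: Notation: $'$ denotes transpose; $\|\cdot\|$ is the Euclidean norm; matrix inequalities are in the sense of symmetric matrices; products $\prod_{j=\ell}^n M_j$ of matrices mean $M_n\cdots M_\ell$; $\xi_0^n=(\xi_0,\dots,\xi_n)$, $\gamma_0^n=(\gamma_0,\dots,\gamma_n)$. Setting: $f:\mathbb R^N\to\mathbb R^N$, $B\in\mathbb R^{N\times d}$, $k:\mathbb R^N\to\mathbb R^d$. $\xi_n\in\mathbb R$ is an IID sequence with $E[\xi_n]=\mu$, $E[(\xi_n-\mu)^2]=\sigma^2\ne 0$. $\gamma_n\in\mathbb R^N$ is an IID sequence with $E[\gamma_n]=0$, $E[\|\gamma_n\|^2]\le C$ for a constant $C$. $w_n\in\mathbb R^d$ is an exogenous deterministic input sequence. Assumptions: (1) $f$ is at least $C^1$; $\frac{\partial f}{\partial x}(x)$ is invertible and uniformly bounded for Lebesgue almost all $x\in\mathbb R^N$ and for $x=0$; $x=0$ is an equilibrium ($f(0)=0$) and all eigenvalues $\lambda_0^i$, $i=1,\dots,N$, of $\frac{\partial f}{\partial x}(0)$ satisfy $|\lambda_0^i|>1$; $B'B>0$. (2) There exist $k_1,k_2>0$ and an integer $m\ge0$ such that $k_1I\le\sum_{\ell=0}^{m}\Phi(x_m,x_\ell)BB'\Phi'(x_m,x_\ell)\le k_2I$ for Lebesgue almost all $x_0\in\mathbb R^N$ and for $x_0=0$, where $x_{n+1}=f(x_n)$ and $\Phi(x_n,x_\ell)=\prod_{j=\ell}^n\frac{\partial f}{\partial x}(x_j)$. (3) The controller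 $k$ is memoryless, deterministic, at least $C^1$, has uniformly bounded Jacobian, $k(0)=0$, and for some $\alpha>0$, $\left(\frac{\partial f}{\partial x}+\mu B\frac{\partial k}{\partial x}\right)'\left(\frac{\partial f}{\partial x}+\mu B\frac{\partial k}{\partial x}\right)\ge\alpha I$ for almost all $x\in\mathbb R^N$. (4) The system $x_{n+1}=f(x_n)$ has a unique physical invariant measure with all its Lyapunov exponents positive. Definitions for (4). A Borel probability measure $\nu$ on $\mathbb R^N$ is invariant for $x_{n+1}=f(x_n)$ if $\nu(S)=\nu(f^{-1}(S))$ for all Borel $S$; it is ergodic if every set $S$ with $f^{-1}(S)=S$ has $\nu(S)\in\{0,1\}$. An ergodic invariant measure $\nu$ is physical if $$\lim_{n\to\infty}\frac1n\sum_{j=0}^n\varphi(x_j)=\int_{\mathbb R^N}\varphi\,d\nu$$ for a positive Lebesgue measure set of initial conditions $x_0$ and all continuous $\varphi:\mathbb R^N\to\mathbb R$; it is the unique physical measure if this holds for Lebesgue almost all $x_0\in\mathbb R^N$ and all continuous $\varphi$. Lyapunov exponents: for $x_{n+1}=f(x_n)$, $x_0=x$, let $$L(x)=\lim_{n\to\infty}\left[\left(\prod_{j=0}^n\frac{\partial f}{\partial x}(x_j)\right)'\left(\prod_{j=0}^n\frac{\partial f}{\partial x}(x_j)\right)\right]^{\frac1{2n}} .$$ If $\lambda^i_{exp}$, $i=1,\dots,N$, are the eigenvalues of $L(x)$, the Lyapunov exponents are $\Lambda^i_{exp}=\log\lambda^i_{exp}$. Under the assumption of a unique physical invariant measure, these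 limits and the Lyapunov exponents are taken to be independent of the (Lebesgue-typical) initial condition. The system $\mathcal S$ is the pair of systems $$x_{n+1}=f(x_n)+\xi_nBk(x_n)+\xi_nBw_n+\gamma_n,\qquad x_{n+1}=f(x_n)+\xi_nBk(x_n)+\xi_nBw_n .$$ $\mathcal S$ is mean-square exponential incrementally stable if there exist positive constants $K<\infty$ and $\beta<1$ such that, for Lebesgue almost all $x_0,y_0\in\mathbb R^N$ and in particular for $x_0=0$, for any $w_n$ (including $w_n\equiv0$), and both with and without the additive noise term $\gamma_n$, $$E_{\mathcal X_0^n}\left[\|x_{n+1}-y_{n+1}\|^2\right]\le K\beta^n\|x_0-y_0\|^2\quad\forall n\ge0,$$ where $\{x_n\},\{y_n\}$ are trajectories starting from $x_0,y_0$ and subject to the same sequences $w_n$, $\xi_n$, $\gamma_n$, and $\mathcal X_0^n$ is $\{\xi_0^n,\gamma_0^n\}$ with noise and $\{\xi_0^n\}$ without noise. *)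

theory Defs
  imports "HOL-Probability.Probability" "HOL-Computational_Algebra.Computational_Algebra"
begin

section \<open>Matrices\<close>

(* Addition, subtraction and scaling on real^'n^'n are the matrix ones, but * and ^ act
   componentwise; products and powers of matrices must therefore go through **. *)

definition mat_power :: "real^'n^'n \<Rightarrow> nat \<Rightarrow> real^'n^'n" where
  "mat_power A p = (((**) A) ^^ p) (mat 1)"

(* M n ** ... ** M l *)
definition mat_prod :: "(nat \<Rightarrow> real^'n^'n) \<Rightarrow> nat \<Rightarrow> nat \<Rightarrow> real^'n^'n" where
  "mat_prod M l n = fold (\<lambda>j P. M j ** P) [l..<Suc n] (mat 1)"

definition mat_le :: "real^'n^'n \<Rightarrow> real^'n^'n \<Rightarrow> bool" where
  "mat_le A C \<longleftrightarrow> transpose A = A \<and> transpose C = C \<and> (\<forall>v. 0 \<le> v \<bullet> ((C - A) *v v))"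

definition mat_less :: "real^'n^'n \<Rightarrow> real^'n^'n \<Rightarrow> bool" where
  "mat_less A C \<longleftrightarrow> transpose A = A \<and> transpose C = C \<and> (\<forall>v. v \<noteq> 0 \<longrightarrow> 0 < v \<bullet> ((C - A) *v v))"

(* R is the p-th root (p > 0) of the positive semidefinite matrix A in the sense of the functional
   calculus, A^(1/p): the only positive semidefinite matrix whose p-th power is A. *)
definition is_psd_root :: "nat \<Rightarrow> real^'n^'n \<Rightarrow> real^'n^'n \<Rightarrow> bool" where
  "is_psd_root p A R \<longleftrightarrow> mat_le 0 R \<and> mat_power R p = A"

definition char_polynomial :: "real^'n^'n \<Rightarrow> complex poly" where
  "char_polynomial A = det (mat [:0, 1:] - map_matrix (\<lambda>a. [:complex_of_real a:]) A)"

(* complex eigenvalues, repeated according to algebraic multiplicity *)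
definition eigenvalues :: "real^'n^'n \<Rightarrow> complex multiset" where
  "eigenvalues A = proots (char_polynomial A)"


section \<open>Smooth maps and the autonomous system $x_{n+1} = f(x_n)$\<close>

abbreviation Jac :: "(real^'m \<Rightarrow> real^'p) \<Rightarrow> real^'m \<Rightarrow> real^'m^'p" where
  "Jac g x \<equiv> jacobian g (at x)"

definition C1_map :: "(real^'m \<Rightarrow> real^'p) \<Rightarrow> bool" where
  "C1_map g \<longleftrightarrow> (\<forall>x. g differentiable (at x)) \<and> continuous_on UNIV (\<lambda>x. Jac g x)"

(* Jac f (x_n) ** ... ** Jac f (x_l) along the orbit x_j = f^j(x) *)
definition transition_matrix :: "(real^'n \<Rightarrow> real^'n) \<Rightarrow> real^'n \<Rightarrow> nat \<Rightarrow> nat \<Rightarrow> real^'n^'n" where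
  "transition_matrix f x n l = mat_prod (\<lambda>j. Jac f ((f ^^ j) x)) l n"

definition invariant_measure :: "(real^'n \<Rightarrow> real^'n) \<Rightarrow> (real^'n) measure \<Rightarrow> bool" where
  "invariant_measure f \<nu> \<longleftrightarrow> prob_space \<nu> \<and> sets \<nu> = sets borel \<and>
     (\<forall>S\<in>sets borel. emeasure \<nu> S = emeasure \<nu> (f -` S))"

definition ergodic_measure :: "(real^'n \<Rightarrow> real^'n) \<Rightarrow> (real^'n) measure \<Rightarrow> bool" where
  "ergodic_measure f \<nu> \<longleftrightarrow> invariant_measure f \<nu> \<and>
     (\<forall>S\<in>sets borel. f -` S = S \<longrightarrow> measure \<nu> S \<in> {0, 1})"

(* Initial conditions whose time averages converge to the space average of every continuous
   observable.  Integrability is explicit because the Bochner integral of a non-integrable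
   function is 0 by convention. *)
definition basin :: "(real^'n \<Rightarrow> real^'n) \<Rightarrow> (real^'n) measure \<Rightarrow> (real^'n) set" where
  "basin f \<nu> = {x. \<forall>\<phi>::real^'n \<Rightarrow> real. continuous_on UNIV \<phi> \<longrightarrow> integrable \<nu> \<phi> \<and>
     (\<lambda>n. 1 / real n * (\<Sum>j=0..n. \<phi> ((f ^^ j) x))) \<longlonglongrightarrow> (\<integral>z. \<phi> z \<partial>\<nu>)}"

definition physical_measure :: "(real^'n \<Rightarrow> real^'n) \<Rightarrow> (real^'n) measure \<Rightarrow> bool" where
  "physical_measure f \<nu> \<longleftrightarrow> ergodic_measure f \<nu> \<and>
     (\<exists>S\<in>sets lebesgue. 0 < emeasure lebesgue S \<and> S \<subseteq> basin f \<nu>)"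

definition unique_physical_measure :: "(real^'n \<Rightarrow> real^'n) \<Rightarrow> (real^'n) measure \<Rightarrow> bool" where
  "unique_physical_measure f \<nu> \<longleftrightarrow> physical_measure f \<nu> \<and> (AE x in lebesgue. x \<in> basin f \<nu>)"

definition lyapunov_matrix :: "(real^'n \<Rightarrow> real^'n) \<Rightarrow> real^'n \<Rightarrow> real^'n^'n \<Rightarrow> bool" where
  "lyapunov_matrix f x L \<longleftrightarrow> (\<exists>R.
     (\<forall>n>0. is_psd_root (2 * n)
        (transpose (transition_matrix f x n 0) ** transition_matrix f x n 0) (R n)) \<and>
     R \<longlonglongrightarrow> L)"

(* The Lyapunov exponents at x, with multiplicity, are the family Lam (in some order). *)
definition lyapunov_exponents :: "(real^'n \<Rightarrow> real^'n) \<Rightarrow> real^'n \<Rightarrow> ('n \<Rightarrow> real) \<Rightarrow> bool" where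
  "lyapunov_exponents f x Lam \<longleftrightarrow> (\<exists>L lam. lyapunov_matrix f x L \<and>
     eigenvalues L = image_mset (\<lambda>i. complex_of_real (lam i)) (mset_set UNIV) \<and>
     (\<forall>i. 0 < lam i \<and> Lam i = ln (lam i)))"


section \<open>Standing assumptions\<close>

definition unstable_plant :: "(real^'n \<Rightarrow> real^'n) \<Rightarrow> real^'d^'n \<Rightarrow> bool" where
  "unstable_plant f B \<longleftrightarrow>
     C1_map f \<and>
     (AE x in lebesgue. invertible (Jac f x)) \<and> invertible (Jac f 0) \<and>
     (\<exists>b. (AE x in lebesgue. onorm ((*v) (Jac f x)) \<le> b) \<and> onorm ((*v) (Jac f 0)) \<le> b) \<and>
     f 0 = 0 \<and>
     (\<forall>z \<in># eigenvalues (Jac f 0). 1 < cmod z) \<and>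
     mat_less 0 (transpose B ** B)"

definition gramian :: "(real^'n \<Rightarrow> real^'n) \<Rightarrow> real^'d^'n \<Rightarrow> nat \<Rightarrow> real^'n \<Rightarrow> real^'n^'n" where
  "gramian f B m x = (\<Sum>l=0..m. transition_matrix f x m l ** B ** transpose B **
                               transpose (transition_matrix f x m l))"

definition uniformly_controllable :: "(real^'n \<Rightarrow> real^'n) \<Rightarrow> real^'d^'n \<Rightarrow> bool" where
  "uniformly_controllable f B \<longleftrightarrow> (\<exists>k1>0. \<exists>k2>0. \<exists>m.
     let ok = (\<lambda>x. mat_le (k1 *\<^sub>R mat 1) (gramian f B m x) \<and> mat_le (gramian f B m x) (k2 *\<^sub>R mat 1))
     in (AE x in lebesgue. ok x) \<and> ok 0)"

definition admissible_controller ::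
  "(real^'n \<Rightarrow> real^'n) \<Rightarrow> real^'d^'n \<Rightarrow> real \<Rightarrow> (real^'n \<Rightarrow> real^'d) \<Rightarrow> bool" where
  "admissible_controller f B \<mu> k \<longleftrightarrow>
     C1_map k \<and>
     (\<exists>b. \<forall>x. onorm ((*v) (Jac k x)) \<le> b) \<and>
     k 0 = 0 \<and>
     (\<exists>\<alpha>>0. AE x in lebesgue.
        mat_le (\<alpha> *\<^sub>R mat 1)
          (transpose (Jac f x + \<mu> *\<^sub>R (B ** Jac k x)) ** (Jac f x + \<mu> *\<^sub>R (B ** Jac k x))))"

(* The exponents are required to be the same family Lam for Lebesgue almost every initial condition;
   the eigenvectors of the Lyapunov matrix may depend on the initial condition. *)
definition positive_lyapunov_dynamics :: "(real^'n \<Rightarrow> real^'n) \<Rightarrow> ('n \<Rightarrow> real) \<Rightarrow> bool" where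
  "positive_lyapunov_dynamics f Lam \<longleftrightarrow>
     (\<exists>\<nu>. unique_physical_measure f \<nu>) \<and>
     (AE x in lebesgue. lyapunov_exponents f x Lam) \<and>
     (\<forall>i. 0 < Lam i)"

definition iid :: "'s measure \<Rightarrow> (nat \<Rightarrow> 's \<Rightarrow> 'e::topological_space) \<Rightarrow> bool" where
  "iid M X \<longleftrightarrow> prob_space.indep_vars M (\<lambda>_. borel) X UNIV \<and>
     (\<forall>n. distr M borel (X n) = distr M borel (X 0))"

definition channel_noise :: "'s measure \<Rightarrow> (nat \<Rightarrow> 's \<Rightarrow> real) \<Rightarrow> real \<Rightarrow> real \<Rightarrow> bool" where
  "channel_noise M \<xi> \<mu> \<sigma> \<longleftrightarrow> iid M \<xi> \<and>
     (\<forall>n. integrable M (\<xi> n) \<and> (\<integral>\<omega>. \<xi> n \<omega> \<partial>M) = \<mu> \<and>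
          integrable M (\<lambda>\<omega>. (\<xi> n \<omega> - \<mu>)\<^sup>2) \<and> (\<integral>\<omega>. (\<xi> n \<omega> - \<mu>)\<^sup>2 \<partial>M) = \<sigma>\<^sup>2) \<and>
     \<sigma>\<^sup>2 \<noteq> 0"

definition additive_noise :: "'s measure \<Rightarrow> (nat \<Rightarrow> 's \<Rightarrow> real^'n) \<Rightarrow> real \<Rightarrow> bool" where
  "additive_noise M \<gamma> C \<longleftrightarrow> iid M \<gamma> \<and>
     (\<forall>n. integrable M (\<gamma> n) \<and> (\<integral>\<omega>. \<gamma> n \<omega> \<partial>M) = 0 \<and>
          integrable M (\<lambda>\<omega>. (norm (\<gamma> n \<omega>))\<^sup>2) \<and> (\<integral>\<omega>. (norm (\<gamma> n \<omega>))\<^sup>2 \<partial>M) \<le> C)"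


section \<open>The closed loop and its stability\<close>

primrec closed_loop :: "(real^'n \<Rightarrow> real^'n) \<Rightarrow> real^'d^'n \<Rightarrow> (real^'n \<Rightarrow> real^'d) \<Rightarrow>
    (nat \<Rightarrow> real^'d) \<Rightarrow> (nat \<Rightarrow> real) \<Rightarrow> (nat \<Rightarrow> real^'n) \<Rightarrow> real^'n \<Rightarrow> nat \<Rightarrow> real^'n" where
  "closed_loop f B k w \<xi> \<gamma> x 0 = x"
| "closed_loop f B k w \<xi> \<gamma> x (Suc n) =
     (let z = closed_loop f B k w \<xi> \<gamma> x n
      in f z + \<xi> n *\<^sub>R (B *v k z) + \<xi> n *\<^sub>R (B *v w n) + \<gamma> n)"

(* The expectation is a nonnegative integral with values in [0,\<infinity>]. *)
definition incremental_bound :: "'s measure \<Rightarrow> (real^'n \<Rightarrow> real^'n) \<Rightarrow> real^'d^'n \<Rightarrow>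
    (real^'n \<Rightarrow> real^'d) \<Rightarrow> (nat \<Rightarrow> 's \<Rightarrow> real) \<Rightarrow> (nat \<Rightarrow> 's \<Rightarrow> real^'n) \<Rightarrow>
    real \<Rightarrow> real \<Rightarrow> real^'n \<Rightarrow> real^'n \<Rightarrow> bool" where
  "incremental_bound M f B k \<xi> \<gamma> K \<beta> x y \<longleftrightarrow> (\<forall>w n.
     (\<integral>\<^sup>+\<omega>. ennreal ((norm (closed_loop f B k w (\<lambda>j. \<xi> j \<omega>) (\<lambda>j. \<gamma> j \<omega>) x (Suc n) -
                         closed_loop f B k w (\<lambda>j. \<xi> j \<omega>) (\<lambda>j. \<gamma> j \<omega>) y (Suc n)))\<^sup>2) \<partial>M)
     \<le> ennreal (K * \<beta> ^ n * (norm (x - y))\<^sup>2))"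

(* The noise-free member of the pair of systems is the instance of zero additive noise. *)
definition ms_exp_incrementally_stable :: "'s measure \<Rightarrow> (real^'n \<Rightarrow> real^'n) \<Rightarrow> real^'d^'n \<Rightarrow>
    (real^'n \<Rightarrow> real^'d) \<Rightarrow> (nat \<Rightarrow> 's \<Rightarrow> real) \<Rightarrow> (nat \<Rightarrow> 's \<Rightarrow> real^'n) \<Rightarrow> bool" where
  "ms_exp_incrementally_stable M f B k \<xi> \<gamma> \<longleftrightarrow> (\<exists>K>0. \<exists>\<beta>>0. \<beta> < 1 \<and>
     (\<forall>g\<in>{\<gamma>, \<lambda>_ _. 0}.
        (AE x in lebesgue. AE y in lebesgue. incremental_bound M f B k \<xi> g K \<beta> x y) \<and>
        (AE y in lebesgue. incremental_bound M f B k \<xi> g K \<beta> 0 y)))"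

end

theory Submission
  imports Defs
begin

text \<open>
  The inputs in the definition of stability may be chosen freely, and this freedom reduces the claim
  to a linear problem. Feeding \<open>w n = - k (x n)\<close> along an orbit \<open>x\<close> of \<open>f\<close> cancels the channel noise
  exactly on that orbit: one of the two trajectories is then deterministic, and the other one, started
  infinitesimally close to it, follows the random linear system
  \<open>v (n + 1) = (A n + \<xi> n B C n) v n\<close>, where \<open>A n\<close> and \<open>C n\<close> are the Jacobians of \<open>f\<close> and \<open>k\<close> at
  the point \<open>x n\<close>. By Fatou's lemma the incremental bound passes from almost all pairs of
  initial conditions to all pairs, and from difference quotients to derivatives
  (\<open>linearised_mean_square_bound\<close>). Hence the product of these random matrices has second moments
  of size at most \<open>K \<beta> ^ n\<close> along every orbit of \<open>f\<close>, the fixed point \<open>0\<close> included.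

  The second moment of the product is computed by pulling a quadratic form \<open>P\<close> back through one factor
  at a time, by \<open>P \<mapsto> E[(A + \<xi> B C)' P (A + \<xi> B C)]\<close>. Completing the square in \<open>C\<close> bounds the result
  from below by a form that does not involve the controller,
  \<open>A' (P - \<rho> P B (B' P B)\<inverse> B' P) A\<close>: feedback of any kind can remove at most the fraction \<open>\<rho>\<close> of the
  energy, and only in the \<open>d\<close> directions of the range of \<open>B\<close>.
  This has two consequences. As quadratic forms, each step loses at most the factor \<open>\<rho>bar\<close>
  (\<open>moment_step_ge\<close>); in terms of determinants, each step loses at most \<open>\<rho>bar ^ d\<close>
  (\<open>det_moment_step_ge\<close>). So \<open>\<rho>bar ^ n\<close> times the squared norm of the noise-free product
  applied to a unit vector, and \<open>\<rho>bar ^ (d n)\<close> times its squared determinant, decay exponentially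
  (\<open>mean_square_bound_imp\<close>).

  It remains to read off exponential rates. Along a typical orbit the norm and the determinant of the
  noise-free product grow like powers of the largest eigenvalue and of the determinant
  of the Lyapunov matrix (\<open>norm_growth_bound\<close>, \<open>det_growth_bound\<close>); at the fixed point the product is
  a power of the Jacobian, whose growth is governed by its eigenvalues. Comparing the rates gives
  \<open>\<rho>bar \<lambda>\<^sup>2 \<le> \<beta>\<close> and \<open>\<rho>bar ^ d (det)\<^sup>2 \<le> \<beta> ^ N\<close>, and both right-hand sides are less than \<open>1\<close>.
\<close>

section \<open>Eigenvalues and determinants\<close>

lemma det_map_matrix_of_real:
  "det (map_matrix complex_of_real A) = complex_of_real (det A)"
  by (simp add: det_def)

lemma poly_char_polynomial:
  "poly (char_polynomial A) z = det (mat z - map_matrix complex_of_real A)"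
  by (simp add: char_polynomial_def det_def poly_sum poly_prod mat_def if_distrib[of "\<lambda>p. poly p z"] cong: if_cong)

text \<open>Every permutation other than the identity picks an off-diagonal, hence constant, entry; so the
  diagonal term alone contributes in degree \<open>N\<close>.\<close>

lemma char_polynomial_monic:
  fixes A :: "real^'n^'n"
  shows "degree (char_polynomial A) = CARD('n)" and "lead_coeff (char_polynomial A) = 1"
proof -
  define e where "e = (\<lambda>i j. (mat [:0, 1:] - map_matrix (\<lambda>a. [:complex_of_real a:]) A) $ i $ j)"
  define t where "t = (\<lambda>p. of_int (sign p) * (\<Prod>i\<in>UNIV. e i (p i)))"
  have diag: "e i i = [:- complex_of_real (A $ i $ i), 1:]" for i
    by (simp add: e_def mat_def)
  have off: "degree (e i j) = 0" if "i \<noteq> j" for i j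
    using that by (simp add: e_def mat_def)
  have deg_e: "degree (e i j) \<le> 1" for i j
    by (cases "i = j") (simp_all add: diag off)
  have id: "t id = (\<Prod>i\<in>UNIV. [:- complex_of_real (A $ i $ i), 1:])"
    by (simp add: t_def diag)
  have id_deg: "degree (t id) = CARD('n)" and id_lead: "lead_coeff (t id) = 1"
    unfolding id by (simp add: degree_prod_sum_eq, subst lead_coeff_prod, simp)
  have t_deg: "degree (t p) < CARD('n)" if "p permutes UNIV" "p \<noteq> id" for p
  proof -
    obtain i where i: "p i \<noteq> i" using \<open>p \<noteq> id\<close> by (auto simp: fun_eq_iff)
    have "degree (t p) \<le> degree (\<Prod>i\<in>UNIV. e i (p i))"
      unfolding t_def by (rule order.trans[OF degree_mult_le]) simp
    also have "\<dots> \<le> (\<Sum>i\<in>UNIV. degree (e i (p i)))"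
      using degree_prod_sum_le[of UNIV "\<lambda>i. e i (p i)"] by (simp add: o_def)
    also have "\<dots> < (\<Sum>i\<in>(UNIV::'n set). 1)"
    proof (rule sum_strict_mono_ex1)
      show "\<exists>i\<in>UNIV. degree (e i (p i)) < 1" using off[of i "p i"] i by auto
    qed (use deg_e in auto)
    finally show ?thesis by simp
  qed
  have cp: "char_polynomial A = (\<Sum>p\<in>{p. p permutes UNIV}. t p)"
    by (simp add: char_polynomial_def det_def t_def e_def)
  also have "\<dots> = t id + (\<Sum>p\<in>{p. p permutes UNIV} - {id}. t p)"
    by (rule sum.remove) (simp_all add: permutes_id)
  finally have cp: "char_polynomial A = t id + (\<Sum>p\<in>{p. p permutes UNIV} - {id}. t p)" .
  have rest: "degree (\<Sum>p\<in>{p. p permutes UNIV} - {id}. t p) < CARD('n)"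
    by (rule degree_sum_less) (auto simp: t_deg)
  show "degree (char_polynomial A) = CARD('n)" 
    unfolding cp using degree_add_eq_left[of _ "t id"] rest id_deg by simp
  show "lead_coeff (char_polynomial A) = 1"
    unfolding cp using lead_coeff_add_le[of _ "t id"] rest id_deg id_lead
    by (simp add: degree_add_eq_left coeff_eq_0)
qed

lemma det_uminus:
  fixes A :: "'a::comm_ring_1^'n^'n"
  shows "det (- A) = (- 1) ^ CARD('n) * det A"
proof -
  have "- A = (\<chi> i. - 1 *s A $ i)" by (simp add: vec_eq_iff)
  then have "det (- A) = det (\<chi> i. - 1 *s A $ i)" by (rule arg_cong)
  also have "\<dots> = (- 1) ^ CARD('n) * det (\<chi> i. A $ i)"
    using det_rows_mul[of "\<lambda>_. - 1" "\<lambda>i. A $ i"] by simp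
  finally show ?thesis by simp
qed

lemma det_eq_prod_eigenvalues:
  fixes A :: "real^'n^'n"
  shows "complex_of_real (det A) = prod_mset (eigenvalues A)"
proof -
  let ?p = "char_polynomial A"
  have minus: "(\<Prod>x\<in>#M. - x) = (- 1) ^ size M * prod_mset M" for M :: "complex multiset"
    by (induction M) auto
  have "poly ?p 0 = poly (\<Prod>x\<in>#proots ?p. [:-x, 1:]) 0"
    using complex_poly_decompose_multiset[of ?p] char_polynomial_monic(2)[of A] by simp
  also have "\<dots> = (\<Prod>x\<in>#proots ?p. - x)"
    by (simp add: poly_prod_mset)
  also have "\<dots> = (- 1) ^ size (proots ?p) * prod_mset (proots ?p)"
    by (rule minus)
  finally have "poly ?p 0 = (- 1) ^ CARD('n) * prod_mset (eigenvalues A)"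
    by (simp add: size_proots_complex char_polynomial_monic eigenvalues_def)
  moreover have "poly ?p 0 = (- 1) ^ CARD('n) * complex_of_real (det A)"
    using det_uminus[of "map_matrix complex_of_real A"]
    by (simp add: poly_char_polynomial det_map_matrix_of_real)
  ultimately show ?thesis by simp
qed

text \<open>A complex eigenvector \<open>a + \<i> b\<close> of a real matrix, split into real and imaginary part; this keeps
  all later arguments inside real vector spaces.\<close>

lemma eigenvalue_real_pair:
  fixes A :: "real^'n^'n"
  assumes "z \<in># eigenvalues A"
  obtains a b where "a \<noteq> 0 \<or> b \<noteq> 0"
    and "A *v a = Re z *\<^sub>R a - Im z *\<^sub>R b" and "A *v b = Im z *\<^sub>R a + Re z *\<^sub>R b"
proof -
  let ?C = "mat z - map_matrix complex_of_real A"
  have "char_polynomial A \<noteq> 0" using char_polynomial_monic(2)[of A] by auto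
  then have "det ?C = 0"
    using assms by (simp add: eigenvalues_def poly_char_polynomial)
  then obtain c where c: "?C *v c = 0" "c \<noteq> 0"
    by (metis invertible_det_nz invertible_left_inverse matrix_left_invertible_ker)
  define a b where "a = (\<chi> i. Re (c $ i))" and "b = (\<chi> i. Im (c $ i))"
  have eq: "(\<Sum>j\<in>UNIV. complex_of_real (A $ i $ j) * c $ j) = z * c $ i" for i
  proof -
    have "(map_matrix complex_of_real A *v c) $ i = (mat z *v c) $ i"
      using c(1) by (simp add: matrix_vector_mult_diff_rdistrib)
    then show ?thesis by (simp add: matrix_vector_mult_def mat_def if_distrib[of "\<lambda>x. x * _"] cong: if_cong)
  qed
  show thesis
  proof
    show "a \<noteq> 0 \<or> b \<noteq> 0" using c(2) by (auto simp: vec_eq_iff a_def b_def complex_eq_iff)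
    show "A *v a = Re z *\<^sub>R a - Im z *\<^sub>R b"
      using arg_cong[OF eq, of Re] by (simp add: vec_eq_iff matrix_vector_mult_def a_def b_def)
    show "A *v b = Im z *\<^sub>R a + Re z *\<^sub>R b"
      using arg_cong[OF eq, of Im] by (simp add: vec_eq_iff matrix_vector_mult_def a_def b_def algebra_simps)
  qed
qed

text \<open>Invertible matrices are dense: the characteristic polynomial has finitely many roots.\<close>

lemma det_mat_minus_nonzero_at_0:
  fixes X :: "real^'n^'n"
  shows "eventually (\<lambda>e. det (mat e - X) \<noteq> 0) (at 0)"
proof -
  have "finite {z. poly (char_polynomial X) z = 0}"
    using char_polynomial_monic(2)[of X] by (intro poly_roots_finite) auto
  then have "finite {e. poly (char_polynomial X) (complex_of_real e) = 0}"
    using finite_vimageI[of "{z. poly (char_polynomial X) z = 0}" complex_of_real]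
    by (simp add: vimage_def inj_of_real)
  moreover have "poly (char_polynomial X) (complex_of_real e) = complex_of_real (det (mat e - X))" for e
  proof -
    have "mat (complex_of_real e) - map_matrix complex_of_real X = map_matrix complex_of_real (mat e - X)"
      by (simp add: vec_eq_iff mat_def)
    then show ?thesis by (simp add: poly_char_polynomial det_map_matrix_of_real)
  qed
  ultimately have "finite {e. det (mat e - X) = 0}" by simp
  then have "open (- ({e. det (mat e - X) = 0} - {0}))"
    by (intro open_Compl finite_imp_closed) auto
  then show ?thesis unfolding eventually_at_topological by (intro exI) auto
qed

lemma tendsto_det:
  fixes X :: "'b \<Rightarrow> real^'n^'n"
  assumes "(X \<longlongrightarrow> L) F"
  shows "((\<lambda>t. det (X t)) \<longlongrightarrow> det L) F"
  unfolding det_def by (intro tendsto_intros assms)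

lemma tendsto_matrix_mult:
  fixes X :: "'b \<Rightarrow> real^'n^'m" and Y :: "'b \<Rightarrow> real^'p^'n"
  assumes "(X \<longlongrightarrow> L) F" "(Y \<longlongrightarrow> K) F"
  shows "((\<lambda>t. X t ** Y t) \<longlongrightarrow> L ** K) F"
  unfolding matrix_matrix_mult_def by (intro tendsto_vec_lambda tendsto_intros assms)

lemma matrix_add_rdistrib:
  fixes A B :: "real^'n^'m" and C :: "real^'p^'n"
  shows "(A + B) ** C = A ** C + B ** C"
  by (simp add: matrix_matrix_mult_def vec_eq_iff sum.distrib algebra_simps)

text \<open>Sylvester's determinant identity for square factors. For invertible \<open>X\<close> the two matrices are
  conjugate by \<open>X\<close>; the general case follows by perturbing \<open>X\<close> to \<open>X + e I\<close> and letting \<open>e\<close> tend to \<open>0\<close>.\<close>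

lemma det_one_plus_mult_commute:
  fixes X Y :: "real^'n^'n"
  shows "det (mat 1 + X ** Y) = det (mat 1 + Y ** X)"
proof -
  have inv: "det (mat 1 + Z ** Y) = det (mat 1 + Y ** Z)" if "det Z \<noteq> 0" for Z :: "real^'n^'n"
  proof -
    have "det Z * det (mat 1 + Y ** Z) = det (Z ** (mat 1 + Y ** Z))" by (simp add: det_mul)
    also have "Z ** (mat 1 + Y ** Z) = (mat 1 + Z ** Y) ** Z"
      by (simp add: matrix_add_ldistrib matrix_add_rdistrib matrix_mul_assoc)
    also have "det \<dots> = det Z * det (mat 1 + Z ** Y)" by (simp add: det_mul)
    finally show ?thesis using that by simp
  qed
  define Z :: "real \<Rightarrow> real^'n^'n" where "Z e = mat e - (- X)" for e
  have "((\<lambda>e. mat e :: real^'n^'n) \<longlongrightarrow> mat 0) (at 0)"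
    unfolding mat_def
  proof (intro tendsto_vec_lambda)
    show "(\<lambda>e::real. if i = j then e else 0) \<midarrow>0\<rightarrow> (if i = j then 0 else 0)" for i j :: 'n
      by (cases "i = j") auto
  qed
  then have "(Z \<longlongrightarrow> mat 0 - (- X)) (at 0)" unfolding Z_def by (intro tendsto_intros)
  then have Z: "(Z \<longlongrightarrow> X) (at 0)" by (simp add: vec_eq_iff mat_def[of 0] zero_vec_def[symmetric] cong: if_cong)
  have l: "((\<lambda>e. det (mat 1 + Z e ** Y)) \<longlongrightarrow> det (mat 1 + X ** Y)) (at 0)"
    and r: "((\<lambda>e. det (mat 1 + Y ** Z e)) \<longlongrightarrow> det (mat 1 + Y ** X)) (at 0)"
    by (intro tendsto_det tendsto_add tendsto_const tendsto_matrix_mult Z)+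
  have "eventually (\<lambda>e. det (mat 1 + Z e ** Y) = det (mat 1 + Y ** Z e)) (at 0)"
    using det_mat_minus_nonzero_at_0[of "- X"] by eventually_elim (simp add: Z_def inv)
  with l have "((\<lambda>e. det (mat 1 + Y ** Z e)) \<longlongrightarrow> det (mat 1 + X ** Y)) (at 0)"
    by (rule Lim_transform_eventually)
  then show ?thesis using r by (intro tendsto_unique[of "at (0::real)"]) auto
qed

section \<open>Determinants of positive definite matrices\<close>

lemma inner_transpose_mult:
  fixes A :: "real^'n^'m"
  shows "x \<bullet> (transpose A *v y) = (A *v x) \<bullet> y"
  using dot_lmul_matrix[of y A x] by (simp add: inner_commute)

lemma inner_symmetric_mult:
  fixes P :: "real^'n^'n"
  assumes "transpose P = P"
  shows "x \<bullet> (P *v y) = y \<bullet> (P *v x)"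
  using inner_transpose_mult[of x P y] assms by (simp add: inner_commute)

lemma mat_le_0_iff: "mat_le 0 P \<longleftrightarrow> transpose P = P \<and> (\<forall>v. 0 \<le> v \<bullet> (P *v v))"
  and mat_less_0_iff: "mat_less 0 P \<longleftrightarrow> transpose P = P \<and> (\<forall>v. v \<noteq> 0 \<longrightarrow> 0 < v \<bullet> (P *v v))"
  by (simp_all add: mat_le_def mat_less_def) (auto simp: transpose_def vec_eq_iff)

lemma pos_def_imp_pos_semidef: "mat_less 0 P \<Longrightarrow> mat_le 0 P"
  unfolding mat_le_0_iff mat_less_0_iff by (metis inner_zero_left less_eq_real_def)

lemma pos_def_inverse:
  fixes P :: "real^'n^'n"
  assumes "mat_less 0 P"
  obtains G where "G ** P = mat 1" "P ** G = mat 1"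
proof -
  have "P *v x = 0 \<Longrightarrow> x = 0" for x
    using assms by (auto simp: mat_less_def dest!: spec[of _ x])
  then obtain G where "G ** P = mat 1" using matrix_left_invertible_ker[of P] by blast
  moreover from this have "P ** G = mat 1" using matrix_left_right_inverse by blast
  ultimately show thesis using that by blast
qed

text \<open>An eigenvalue of \<open>Y\<inverse> X\<close> is a generalised eigenvalue of the pair: \<open>X c = z Y c\<close>. Pairing with \<open>c\<close>
  shows that \<open>z\<close> is the quotient of two real quadratic forms. Working with \<open>Y\<inverse> X\<close> directly avoids
  square roots and diagonalisation of symmetric matrices.\<close>

lemma relative_eigenvalue_real:
  fixes X Y G :: "real^'n^'n"
  assumes X: "transpose X = X" and Y: "mat_less 0 Y" and G: "Y ** G = mat 1"
    and z: "z \<in># eigenvalues (G ** X)"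
  obtains u where "u \<noteq> 0" "Im z = 0" "u \<bullet> (X *v u) = Re z * (u \<bullet> (Y *v u))"
proof -
  from eigenvalue_real_pair[OF z] obtain a b where ab: "a \<noteq> 0 \<or> b \<noteq> 0"
    and a: "(G ** X) *v a = Re z *\<^sub>R a - Im z *\<^sub>R b"
    and b: "(G ** X) *v b = Im z *\<^sub>R a + Re z *\<^sub>R b" by blast
  have YGX: "Y *v ((G ** X) *v v) = X *v v" for v
    by (simp add: matrix_vector_mul_assoc matrix_mul_assoc G)
  have Xa: "X *v a = Re z *\<^sub>R (Y *v a) - Im z *\<^sub>R (Y *v b)"
    using YGX[of a] unfolding a by (simp add: matrix_vector_mult_diff_distrib matrix_vector_mult_scaleR)
  have Xb: "X *v b = Im z *\<^sub>R (Y *v a) + Re z *\<^sub>R (Y *v b)"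
    using YGX[of b] unfolding b by (simp add: matrix_vector_right_distrib matrix_vector_mult_scaleR)
  have pos: "0 < v \<bullet> (Y *v v)" if "v \<noteq> 0" for v
    using Y that by (simp add: mat_less_def)
  have nonneg: "0 \<le> v \<bullet> (Y *v v)" for v
    using pos[of v] by (cases "v = 0") auto
  have "Im z * (a \<bullet> (Y *v a) + b \<bullet> (Y *v b)) = b \<bullet> (X *v a) * (-1) + a \<bullet> (X *v b)"
    using inner_symmetric_mult[of Y a b] Y unfolding Xa Xb
    by (simp add: inner_diff_right inner_add_right mat_less_def algebra_simps)
  also have "\<dots> = 0" using inner_symmetric_mult[OF X, of a b] by simp
  finally have im: "Im z = 0"
    using ab pos[of a] pos[of b] nonneg[of a] nonneg[of b] by (auto simp: add_nonneg_eq_0_iff)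
  show thesis
  proof (cases "a = 0")
    case False
    then show ?thesis using that[of a] im by (simp add: Xa)
  next
    case True
    then show ?thesis using that[of b] im ab by (simp add: Xb)
  qed
qed

lemma det_relative_prod:
  fixes X Y G :: "real^'n^'n"
  assumes X: "transpose X = X" and Y: "mat_less 0 Y" and G: "Y ** G = mat 1"
  obtains R where "det (G ** X) = prod_mset R"
    and "\<And>r. r \<in># R \<Longrightarrow> \<exists>u. u \<noteq> 0 \<and> u \<bullet> (X *v u) = r * (u \<bullet> (Y *v u))"
proof
  let ?E = "eigenvalues (G ** X)"
  let ?R = "image_mset Re ?E"
  have of_real_prod: "(\<Prod>z\<in>#M. complex_of_real (Re z)) = complex_of_real (\<Prod>z\<in>#M. Re z)" for M
    by (induction M) auto
  have "image_mset (\<lambda>z. complex_of_real (Re z)) ?E = image_mset (\<lambda>z. z) ?E"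
    by (intro image_mset_cong) (metis X Y G complex_is_Real_iff of_real_Re relative_eigenvalue_real)
  then have "prod_mset ?E = (\<Prod>z\<in>#?E. complex_of_real (Re z))" by simp
  also have "\<dots> = complex_of_real (prod_mset ?R)"
    by (rule of_real_prod)
  finally show "det (G ** X) = prod_mset ?R"
    using det_eq_prod_eigenvalues[of "G ** X"] by simp
  show "\<exists>u. u \<noteq> 0 \<and> u \<bullet> (X *v u) = r * (u \<bullet> (Y *v u))" if "r \<in># ?R" for r
    using that relative_eigenvalue_real[OF X Y G] by (metis (no_types, lifting) imageE set_image_mset)
qed

lemma det_pos_def:
  fixes Y :: "real^'n^'n"
  assumes "mat_less 0 Y"
  shows "0 < det Y"
proof -
  have one: "mat_less 0 (mat 1 :: real^'n^'n)" 
    by (simp add: mat_less_0_iff)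
  have "transpose Y = Y" using assms by (simp add: mat_less_def)
  from det_relative_prod[OF this one, of "mat 1"] obtain R where
    R: "det Y = prod_mset R" "\<And>r. r \<in># R \<Longrightarrow> \<exists>u. u \<noteq> 0 \<and> u \<bullet> (Y *v u) = r * (u \<bullet> u)" by auto
  have "0 < r" if r: "r \<in># R" for r
  proof -
    obtain u where u: "u \<noteq> 0" "u \<bullet> (Y *v u) = r * (u \<bullet> u)" using R(2)[OF r] by blast
    then have "0 < r * (u \<bullet> u)" using assms by (metis diff_zero mat_less_def)
    then show ?thesis using u(1) by (meson inner_gt_zero_iff zero_less_mult_pos2)
  qed
  then have "0 < prod_mset R" by (induction R) auto
  then show ?thesis by (simp add: R(1))
qed

text \<open>All eigenvalues of \<open>Y\<inverse> X\<close> are Rayleigh quotients of \<open>X\<close> relative to \<open>Y\<close>, hence at least \<open>1\<close>, and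
  so is their product \<open>det X / det Y\<close>.\<close>

lemma det_mono_pos_def:
  fixes X Y :: "real^'n^'n"
  assumes X: "transpose X = X" and Y: "mat_less 0 Y"
    and le: "\<And>v. v \<bullet> (Y *v v) \<le> v \<bullet> (X *v v)"
  shows "det Y \<le> det X"
proof -
  obtain G where G: "G ** Y = mat 1" "Y ** G = mat 1" using pos_def_inverse[OF Y] .
  from det_relative_prod[OF X Y G(2)] obtain R where
    R: "det (G ** X) = prod_mset R" "\<And>r. r \<in># R \<Longrightarrow> \<exists>u. u \<noteq> 0 \<and> u \<bullet> (X *v u) = r * (u \<bullet> (Y *v u))" by auto
  have "1 \<le> r" if r: "r \<in># R" for r
  proof -
    obtain u where u: "u \<noteq> 0" "u \<bullet> (X *v u) = r * (u \<bullet> (Y *v u))" using R(2)[OF r] by blast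
    have "0 < u \<bullet> (Y *v u)" using Y u(1) by (simp add: mat_less_def)
    moreover have "1 * (u \<bullet> (Y *v u)) \<le> r * (u \<bullet> (Y *v u))" using le[of u] u(2) by simp
    ultimately show ?thesis by (simp only: mult_le_cancel_right)
  qed
  then have "1 \<le> prod_mset R"
  proof (induction R)
    case (add r R)
    then show ?case using mult_mono[of 1 r 1 "prod_mset R"] by fastforce
  qed simp
  then have "det Y * 1 \<le> det Y * det (G ** X)"
    using det_pos_def[OF Y] R(1) by (intro mult_left_mono) auto
  also have "\<dots> = det (Y ** (G ** X))" by (simp add: det_mul)
  also have "\<dots> = det X" by (simp add: matrix_mul_assoc G)
  finally show ?thesis by simp
qed

text \<open>Sylvester's identity for rectangular factors would give \<open>det (1 - r W B)\<close>, a \<open>d\<close> by \<open>d\<close> determinant.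
  It is reduced to the square case by padding \<open>B\<close> with zero columns and \<open>W\<close> with zero rows along an
  embedding \<open>e\<close> of the small index type into the large one; the padded \<open>W B\<close> is diagonal.\<close>

lemma det_low_rank_update:
  fixes B :: "real^'d^'n" and W :: "real^'n^'d"
  assumes WB: "W ** B = mat 1" and card: "CARD('d) \<le> CARD('n)"
  shows "det (mat 1 - r *\<^sub>R (B ** W)) = (1 - r) ^ CARD('d)"
proof -
  obtain e :: "'d \<Rightarrow> 'n" where e: "inj e" 
    using card_le_inj[of "UNIV :: 'd set" "UNIV :: 'n set"] card by auto
  define B' :: "real^'n^'n" where
    "B' = (\<chi> i j. if j \<in> range e then B $ i $ inv e j else 0)"
  define W' :: "real^'n^'n" where
    "W' = (\<chi> j i. if j \<in> range e then - r * W $ inv e j $ i else 0)"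
  have "(B' ** W') $ i $ k = (- r *\<^sub>R (B ** W)) $ i $ k" for i k
  proof -
    have "(B' ** W') $ i $ k = (\<Sum>j\<in>UNIV. if j \<in> range e then B $ i $ inv e j * (- r * W $ inv e j $ k) else 0)"
      unfolding B'_def W'_def matrix_matrix_mult_def by (auto intro!: sum.cong)
    also have "\<dots> = (\<Sum>j\<in>range e. B $ i $ inv e j * (- r * W $ inv e j $ k))"
      by (subst sum.inter_restrict[symmetric]) auto
    also have "\<dots> = (\<Sum>d\<in>UNIV. B $ i $ d * (- r * W $ d $ k))"
      by (subst sum.reindex[OF e]) (simp add: e)
    also have "\<dots> = - r * (B ** W) $ i $ k"
      by (simp add: matrix_matrix_mult_def sum_distrib_left mult_ac sum_negf)
    finally show ?thesis by simp
  qed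
  then have BW: "B' ** W' = - r *\<^sub>R (B ** W)" by (simp add: vec_eq_iff)
  have "(W' ** B') $ j $ k = (if j = k \<and> j \<in> range e then - r else 0)" for j k
  proof (cases "j \<in> range e \<and> k \<in> range e")
    case True
    then have "(W' ** B') $ j $ k = - r * (W ** B) $ inv e j $ inv e k"
      by (simp add: B'_def W'_def matrix_matrix_mult_def sum_distrib_left mult_ac sum_negf)
    also have "\<dots> = (if j = k \<and> j \<in> range e then - r else 0)"
      using True e by (auto simp: WB mat_def inj_eq)
    finally show ?thesis .
  next
    case False
    then show ?thesis by (auto simp: B'_def W'_def matrix_matrix_mult_def)
  qed
  then have diag: "(mat 1 + W' ** B') $ j $ k = (if j = k then if j \<in> range e then 1 - r else 1 else 0)" for j k
    by (simp add: mat_def)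
  have "det (mat 1 - r *\<^sub>R (B ** W)) = det (mat 1 + B' ** W')" by (simp add: BW)
  also have "\<dots> = det (mat 1 + W' ** B')" by (rule det_one_plus_mult_commute)
  also have "\<dots> = (\<Prod>j\<in>UNIV. (mat 1 + W' ** B') $ j $ j)"
    by (rule det_diagonal) (simp only: diag if_False)
  also have "\<dots> = (\<Prod>j\<in>UNIV. if j \<in> range e then 1 - r else 1)" by (simp only: diag refl if_True)
  also have "\<dots> = (1 - r) ^ card (range e)"
    by (subst prod.inter_restrict[symmetric]) auto
  also have "card (range e) = CARD('d)" using e by (simp add: card_image)
  finally show ?thesis .
qed

section \<open>Second moments under one random factor\<close>

text \<open>The form \<open>E[(A + \<xi> E)' P (A + \<xi> E)]\<close> when \<open>\<xi>\<close> has mean \<open>m\<close> and second moment \<open>s\<close>.\<close>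

definition moment_step :: "real \<Rightarrow> real \<Rightarrow> real^'n^'n \<Rightarrow> real^'n^'n \<Rightarrow> real^'n^'n \<Rightarrow> real^'n^'n" where
  "moment_step m s A E P =
     transpose A ** P ** A + m *\<^sub>R (transpose A ** P ** E + transpose E ** P ** A)
       + s *\<^sub>R (transpose E ** P ** E)"

lemma transpose_add: "transpose (A + B) = transpose A + transpose B"
  by (simp add: transpose_def vec_eq_iff)

lemma transpose_diff: "transpose (A - B :: real^'n^'m) = transpose A - transpose B"
  by (simp add: transpose_def vec_eq_iff)

lemma matrix_diff_ldistrib:
  fixes P :: "real^'n^'m" and X Y :: "real^'p^'n"
  shows "P ** (X - Y) = P ** X - P ** Y"
  by (simp add: matrix_matrix_mult_def vec_eq_iff sum_subtractf algebra_simps)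

lemma moment_step_symmetric:
  assumes "transpose P = P"
  shows "transpose (moment_step m s A E P) = moment_step m s A E P"
  by (simp add: moment_step_def transpose_add transpose_scalar matrix_transpose_mul assms
        matrix_mul_assoc add.commute)

lemma inner_congruence:
  fixes A :: "real^'n^'m" and E :: "real^'p^'m" and P :: "real^'m^'m"
  shows "x \<bullet> ((transpose A ** P ** E) *v y) = (A *v x) \<bullet> (P *v (E *v y))"
proof -
  have "(transpose A ** P ** E) *v y = transpose A *v (P *v (E *v y))"
    by (simp only: matrix_vector_mul_assoc matrix_mul_assoc)
  then show ?thesis by (simp only: inner_transpose_mult)
qed

lemma moment_step_quadratic:
  assumes "transpose P = P"
  shows "v \<bullet> (moment_step m s A E P *v v) =
    (A *v v) \<bullet> (P *v (A *v v)) + 2 * m * ((A *v v) \<bullet> (P *v (E *v v)))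
      + s * ((E *v v) \<bullet> (P *v (E *v v)))"
  unfolding moment_step_def
  by (simp add: matrix_vector_mult_add_rdistrib inner_add_right inner_congruence
        scaleR_matrix_vector_assoc[symmetric] inner_symmetric_mult[OF assms, of "E *v v" "A *v v"]
        algebra_simps)

text \<open>The right-hand side is \<open>s\<close> times the form \<open>H\<close> at \<open>c + (m / s) h\<close>.\<close>

lemma completed_square_nonneg:
  fixes H :: "real^'d^'d"
  assumes "mat_le 0 H" and "s > 0"
  shows "0 \<le> s * (c \<bullet> (H *v c)) + 2 * m * (h \<bullet> (H *v c)) + m\<^sup>2 / s * (h \<bullet> (H *v h))"
proof -
  let ?y = "c + (m / s) *\<^sub>R h"
  have sym: "c \<bullet> (H *v h) = h \<bullet> (H *v c)"
    using assms inner_symmetric_mult[of H c h] by (simp add: mat_le_0_iff)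
  have "0 \<le> s * (?y \<bullet> (H *v ?y))" using assms by (simp add: mat_le_0_iff)
  also have "\<dots> = s * (c \<bullet> (H *v c)) + 2 * m * (h \<bullet> (H *v c)) + m\<^sup>2 / s * (h \<bullet> (H *v h))"
    using assms(2) sym
    by (simp add: matrix_vector_right_distrib matrix_vector_mult_scaleR inner_add_left inner_add_right)
       (simp add: field_simps power2_eq_square)
  finally show ?thesis .
qed

text \<open>With \<open>m\<close> and \<open>s\<close> the first two moments of \<open>\<xi>\<close>, the factor \<open>1 - m\<^sup>2 / s\<close> is \<open>\<rho>bar\<close>. The best
  possible feedback is \<open>E = - (m / s) A\<close>, for which equality holds.\<close>

lemma moment_step_ge:
  assumes P: "mat_le 0 P" and s: "s > 0"
  shows "(1 - m\<^sup>2 / s) * ((A *v v) \<bullet> (P *v (A *v v))) \<le> v \<bullet> (moment_step m s A E P *v v)"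
proof -
  have "transpose P = P" using P by (simp add: mat_le_0_iff)
  then show ?thesis
    using completed_square_nonneg[OF P s, of "E *v v" m "A *v v"]
    by (simp add: moment_step_quadratic algebra_simps)
qed

lemma moment_step_pos_semidef:
  assumes P: "mat_le 0 P" and s: "s > 0" and ms: "m\<^sup>2 \<le> s"
  shows "mat_le 0 (moment_step m s A E P)"
proof -
  have "0 \<le> v \<bullet> (moment_step m s A E P *v v)" for v
  proof -
    have "0 \<le> (1 - m\<^sup>2 / s) * ((A *v v) \<bullet> (P *v (A *v v)))"
      using P s ms by (intro mult_nonneg_nonneg) (simp_all add: mat_le_0_iff)
    then show ?thesis using moment_step_ge[OF P s, of m A v E] by linarith
  qed
  then show ?thesis using P moment_step_symmetric[of P m s A E] by (simp add: mat_le_0_iff)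
qed

lemma moment_step_pos_def:
  assumes P: "mat_less 0 P" and s: "s > 0" and ms: "m\<^sup>2 < s" and A: "det A \<noteq> 0"
  shows "mat_less 0 (moment_step m s A E P)"
proof -
  have "0 < v \<bullet> (moment_step m s A E P *v v)" if "v \<noteq> 0" for v
  proof -
    have "A *v v \<noteq> 0"
      using A that by (metis invertible_det_nz invertible_left_inverse matrix_left_invertible_ker)
    then have "0 < (1 - m\<^sup>2 / s) * ((A *v v) \<bullet> (P *v (A *v v)))"
      using P s ms by (intro mult_pos_pos) (simp_all add: mat_less_0_iff)
    then show ?thesis
      using moment_step_ge[OF pos_def_imp_pos_semidef[OF P] s, of m A v E] by linarith
  qed
  then show ?thesis using P moment_step_symmetric[of P m s A E] by (simp add: mat_less_0_iff)
qed

text \<open>When the feedback acts through \<open>B\<close>, the square is completed in \<open>C v\<close> relative to \<open>H = B' P B\<close>. The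
  minimiser is \<open>- (m / s) W A v\<close>, where \<open>B W\<close> is the projection onto the range of \<open>B\<close> that is orthogonal
  for \<open>P\<close>. The resulting lower bound \<open>Y = A' P (1 - r B W) A\<close> has an explicit determinant, because
  \<open>B W\<close> has rank \<open>d\<close>.\<close>

lemma det_moment_step_ge:
  fixes A P :: "real^'n^'n" and B :: "real^'d^'n" and C :: "real^'n^'d"
  assumes P: "mat_less 0 P" and s: "s > 0" and ms: "m\<^sup>2 < s" and A: "det A \<noteq> 0"
    and B: "mat_less 0 (transpose B ** B)" and card: "CARD('d) \<le> CARD('n)"
  shows "(1 - m\<^sup>2 / s) ^ CARD('d) * (det A)\<^sup>2 * det P \<le> det (moment_step m s A (B ** C) P)"
proof -
  define r where "r = m\<^sup>2 / s"
  have r: "0 \<le> r" "r < 1" using s ms by (auto simp: r_def)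
  have Psym: "transpose P = P" using P by (simp add: mat_less_0_iff)
  have Bnz: "B *v c \<noteq> 0" if "c \<noteq> 0" for c
  proof
    assume "B *v c = 0"
    moreover have "0 < c \<bullet> ((transpose B ** B) *v c)" using B that by (simp add: mat_less_0_iff)
    ultimately show False by (simp add: matrix_vector_mul_assoc[symmetric])
  qed
  define H where "H = transpose B ** P ** B"
  have H: "mat_less 0 H"
    using P Bnz by (simp add: mat_less_0_iff H_def inner_congruence matrix_transpose_mul matrix_mul_assoc)
  obtain G where G: "G ** H = mat 1" "H ** G = mat 1" using pos_def_inverse[OF H] .
  have "transpose G = transpose G ** (H ** G)" by (simp add: G)
  also have "\<dots> = transpose (H ** G) ** G"
    using H by (simp add: mat_less_0_iff matrix_transpose_mul matrix_mul_assoc)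
  finally have Gsym: "transpose G = G" by (simp add: G)
  define W where "W = G ** transpose B ** P"
  have WB: "W ** B = mat 1" using G(1) by (simp add: W_def H_def matrix_mul_assoc)
  define Y where "Y = transpose A ** (P ** (mat 1 - r *\<^sub>R (B ** W))) ** A"
  have PBW: "P ** (mat 1 - r *\<^sub>R (B ** W)) = P - r *\<^sub>R (P ** B ** G ** transpose B ** P)"
    by (simp add: W_def matrix_diff_ldistrib matrix_mul_assoc matrix_scalar_ac scalar_matrix_assoc)
  have Ysym: "transpose Y = Y"
    unfolding Y_def PBW
    by (simp add: matrix_transpose_mul transpose_diff transpose_scalar Psym Gsym matrix_mul_assoc)
  have proj: "x \<bullet> (P *v (B *v c)) = (W *v x) \<bullet> (H *v c)" for x c
  proof -
    have "(W *v x) \<bullet> (H *v c) = c \<bullet> (H *v (W *v x))"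
      using inner_symmetric_mult H by (metis mat_less_0_iff)
    also have "H *v (W *v x) = (H ** G) *v (transpose B *v (P *v x))"
      by (simp only: W_def matrix_vector_mul_assoc matrix_mul_assoc)
    also have "c \<bullet> \<dots> = (B *v c) \<bullet> (P *v x)" by (simp add: G(2) inner_transpose_mult del: transpose_matrix_vector)
    also have "\<dots> = x \<bullet> (P *v (B *v c))" by (rule inner_symmetric_mult[OF Psym])
    finally show ?thesis by simp
  qed
  have WBc: "W *v (B *v c) = c" for c by (simp add: matrix_vector_mul_assoc WB)
  have Yquad: "v \<bullet> (Y *v v) = (A *v v) \<bullet> (P *v (A *v v)) - r * ((W *v (A *v v)) \<bullet> (H *v (W *v (A *v v))))" for v
  proof -
    have "(P ** (mat 1 - r *\<^sub>R (B ** W))) *v x = P *v x - r *\<^sub>R (P *v (B *v (W *v x)))" for x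
      by (simp add: matrix_vector_mul_assoc[symmetric] matrix_vector_mult_diff_rdistrib
          matrix_vector_mult_diff_distrib matrix_vector_mult_scaleR scaleR_matrix_vector_assoc[symmetric])
    then show ?thesis unfolding Y_def by (simp add: inner_congruence inner_diff_right proj)
  qed
  \<comment> \<open>The projection \<open>B W\<close> does not increase the \<open>P\<close>-norm: apply \<open>P \<ge> 0\<close> to the complementary part.\<close>
  have Ypos: "mat_less 0 Y"
  proof -
    have "0 < v \<bullet> (Y *v v)" if "v \<noteq> 0" for v
    proof -
      let ?x = "A *v v"
      let ?h = "W *v ?x"
      let ?y = "?x - B *v ?h"
      have "?x \<noteq> 0" using A that by (metis invertible_det_nz invertible_left_inverse matrix_left_invertible_ker)
      then have pos: "0 < ?x \<bullet> (P *v ?x)" using P by (simp add: mat_less_0_iff)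
      have "0 \<le> ?y \<bullet> (P *v ?y)"
        using pos_def_imp_pos_semidef[OF P] by (simp add: mat_le_0_iff)
      also have "\<dots> = ?x \<bullet> (P *v ?x) - ?h \<bullet> (H *v ?h)"
        using inner_symmetric_mult[OF Psym, of "B *v ?h" ?x]
        by (simp add: matrix_vector_mult_diff_distrib inner_diff_left inner_diff_right proj WBc)
      finally have "?h \<bullet> (H *v ?h) \<le> ?x \<bullet> (P *v ?x)" by simp
      then have "r * (?h \<bullet> (H *v ?h)) \<le> r * (?x \<bullet> (P *v ?x))" using r by (intro mult_left_mono) auto
      also have "\<dots> < 1 * (?x \<bullet> (P *v ?x))" using r pos by (intro mult_strict_right_mono) auto
      finally show ?thesis by (simp add: Yquad)
    qed
    with Ysym show ?thesis by (simp add: mat_less_0_iff)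
  qed
  have le: "v \<bullet> (Y *v v) \<le> v \<bullet> (moment_step m s A (B ** C) P *v v)" for v
    using completed_square_nonneg[OF pos_def_imp_pos_semidef[OF H] s, of "C *v v" m "W *v (A *v v)"]
    by (simp add: moment_step_quadratic[OF Psym] Yquad proj WBc r_def
        matrix_vector_mul_assoc[symmetric])
  have "(1 - r) ^ CARD('d) * (det A)\<^sup>2 * det P = det Y"
    by (simp add: Y_def det_mul det_low_rank_update[OF WB card] power2_eq_square)
  also have "\<dots> \<le> det (moment_step m s A (B ** C) P)"
    by (rule det_mono_pos_def[OF moment_step_symmetric[OF Psym] Ypos le])
  finally show ?thesis by (simp add: r_def)
qed

section \<open>Second moments of products of independent random matrices\<close>

definition iterated_prod :: "(nat \<Rightarrow> real^'n^'n) \<Rightarrow> nat \<Rightarrow> real^'n^'n" where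
  "iterated_prod M n = fold (\<lambda>j P. M j ** P) [0..<n] (mat 1)"

lemma iterated_prod_0 [simp]: "iterated_prod M 0 = mat 1"
  and iterated_prod_Suc: "iterated_prod M (Suc n) = M n ** iterated_prod M n"
  by (simp_all add: iterated_prod_def)

lemma iterated_prod_cong: "(\<And>j. j < n \<Longrightarrow> M j = M' j) \<Longrightarrow> iterated_prod M n = iterated_prod M' n"
  by (induction n) (simp_all add: iterated_prod_Suc)

lemma det_iterated_prod: "det (iterated_prod M n) = (\<Prod>j<n. det (M j))"
  by (induction n) (simp_all add: iterated_prod_Suc det_mul mult.commute)

text \<open>The form \<open>P\<close> is pulled back through the outermost (latest) factor first. That factor is independent
  of all the earlier ones, so the expectation over it can be taken separately.\<close>

primrec iterated_moment ::
  "real \<Rightarrow> real \<Rightarrow> (nat \<Rightarrow> real^'n^'n) \<Rightarrow> (nat \<Rightarrow> real^'n^'n) \<Rightarrow> nat \<Rightarrow> real^'n^'n \<Rightarrow> real^'n^'n" where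
  "iterated_moment m s A E 0 P = P"
| "iterated_moment m s A E (Suc n) P = iterated_moment m s A E n (moment_step m s (A n) (E n) P)"

lemma iterated_moment_ge:
  assumes s: "s > 0" and ms: "m\<^sup>2 \<le> s" and P: "mat_le 0 P"
  shows "(1 - m\<^sup>2 / s) ^ n * ((iterated_prod A n *v v) \<bullet> (P *v (iterated_prod A n *v v)))
    \<le> v \<bullet> (iterated_moment m s A E n P *v v)"
  using P
proof (induction n arbitrary: P)
  case (Suc n)
  let ?x = "iterated_prod A n *v v"
  have "(1 - m\<^sup>2 / s) ^ n * ((1 - m\<^sup>2 / s) * ((A n *v ?x) \<bullet> (P *v (A n *v ?x))))
      \<le> (1 - m\<^sup>2 / s) ^ n * (?x \<bullet> (moment_step m s (A n) (E n) P *v ?x))"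
    using s ms by (intro mult_left_mono moment_step_ge Suc.prems) simp_all
  also have "\<dots> \<le> v \<bullet> (iterated_moment m s A E (Suc n) P *v v)"
    using Suc.IH[OF moment_step_pos_semidef[OF Suc.prems s ms]] by simp
  finally show ?case by (simp add: iterated_prod_Suc matrix_vector_mul_assoc mult_ac)
qed simp

lemma det_iterated_moment_ge:
  fixes A :: "nat \<Rightarrow> real^'n^'n" and B :: "real^'d^'n" and C :: "nat \<Rightarrow> real^'n^'d"
  assumes s: "s > 0" and ms: "m\<^sup>2 < s" and A: "\<And>j. j < n \<Longrightarrow> det (A j) \<noteq> 0"
    and B: "mat_less 0 (transpose B ** B)" and card: "CARD('d) \<le> CARD('n)"
    and P: "mat_less 0 P"
  shows "mat_less 0 (iterated_moment m s A (\<lambda>j. B ** C j) n P) \<and>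
    ((1 - m\<^sup>2 / s) ^ CARD('d)) ^ n * (det (iterated_prod A n))\<^sup>2 * det P
      \<le> det (iterated_moment m s A (\<lambda>j. B ** C j) n P)"
  using A P
proof (induction n arbitrary: P)
  case (Suc n)
  let ?P = "moment_step m s (A n) (B ** C n) P" and ?r = "(1 - m\<^sup>2 / s) ^ CARD('d)"
  have P': "mat_less 0 ?P"
    by (rule moment_step_pos_def[OF _ s ms]) (use Suc.prems in auto)
  have IH: "mat_less 0 (iterated_moment m s A (\<lambda>j. B ** C j) n ?P)"
    "?r ^ n * (det (iterated_prod A n))\<^sup>2 * det ?P \<le> det (iterated_moment m s A (\<lambda>j. B ** C j) n ?P)"
    using Suc.IH[OF _ P'] Suc.prems by auto
  have "?r ^ n * (det (iterated_prod A n))\<^sup>2 * (?r * (det (A n))\<^sup>2 * det P)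
      \<le> ?r ^ n * (det (iterated_prod A n))\<^sup>2 * det ?P"
    using s ms Suc.prems by (intro mult_left_mono det_moment_step_ge B card) simp_all
  also note IH(2)
  finally show ?case using IH(1) by (simp add: iterated_prod_Suc det_mul power_mult_distrib mult_ac)
qed simp

lemma borel_measurable_matrix_mult:
  fixes A :: "real^'n^'m"
  assumes "g \<in> borel_measurable N"
  shows "(\<lambda>x. A *v g x) \<in> borel_measurable N"
  by (rule borel_measurable_continuous_on[OF _ assms])
     (intro linear_continuous_on matrix_vector_mul_bounded_linear)

lemma borel_measurable_iterated_prod:
  fixes A E :: "nat \<Rightarrow> real^'n^'n"
  assumes "k \<le> n"
  shows "(\<lambda>x. iterated_prod (\<lambda>j. A j + x j *\<^sub>R E j) k *v v)
     \<in> borel_measurable (PiM {..<n} (\<lambda>_. borel :: real measure))"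
  using assms
proof (induction k)
  case (Suc k)
  have "(\<lambda>x. x k) \<in> borel_measurable (PiM {..<n} (\<lambda>_. borel :: real measure))"
    using Suc.prems by (intro measurable_component_singleton) auto
  moreover note Suc.IH
  ultimately have "(\<lambda>x. A k *v (iterated_prod (\<lambda>j. A j + x j *\<^sub>R E j) k *v v)
      + x k *\<^sub>R (E k *v (iterated_prod (\<lambda>j. A j + x j *\<^sub>R E j) k *v v)))
     \<in> borel_measurable (PiM {..<n} (\<lambda>_. borel :: real measure))"
    using Suc.prems by (intro borel_measurable_add borel_measurable_scaleR borel_measurable_matrix_mult) auto
  then show ?case
    by (simp add: iterated_prod_Suc matrix_vector_mul_assoc[symmetric] matrix_vector_mult_add_rdistrib
        scaleR_matrix_vector_assoc)
qed simp

text \<open>The vector \<open>z n\<close> depends on \<open>\<xi> 0, \<dots>, \<xi> (n - 1)\<close> only. Expanding the form at \<open>z (n + 1)\<close> gives three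
  forms at \<open>z n\<close> with the coefficients \<open>1\<close>, \<open>\<xi> n\<close> and \<open>(\<xi> n)\<^sup>2\<close>, and independence replaces these
  coefficients by their means. The claim holds for all symmetric \<open>P\<close> at once, as the induction needs
  it for the pulled-back forms.\<close>

lemma second_moment_iterated_prod:
  fixes A E :: "nat \<Rightarrow> real^'n^'n" and \<xi> :: "nat \<Rightarrow> 's \<Rightarrow> real" and v :: "real^'n"
  assumes M: "prob_space M" and noise: "channel_noise M \<xi> \<mu> \<sigma>" and P: "transpose P = P"
  defines "z \<equiv> \<lambda>n \<omega>. iterated_prod (\<lambda>j. A j + \<xi> j \<omega> *\<^sub>R E j) n *v v"
  shows "integrable M (\<lambda>\<omega>. z n \<omega> \<bullet> (P *v z n \<omega>)) \<and>
    (\<integral>\<omega>. z n \<omega> \<bullet> (P *v z n \<omega>) \<partial>M)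
      = v \<bullet> (iterated_moment \<mu> (\<mu>\<^sup>2 + \<sigma>\<^sup>2) A E n P *v v)"
  using P
proof (induction n arbitrary: P)
  case 0
  interpret prob_space M by (rule M)
  show ?case by (simp add: z_def prob_space)
next
  case (Suc n)
  interpret prob_space M by (rule M)
  define s where "s = \<mu>\<^sup>2 + \<sigma>\<^sup>2"
  have ind: "indep_vars (\<lambda>_. borel) \<xi> UNIV"
    and \<xi>: "integrable M (\<xi> n)" "(\<integral>\<omega>. \<xi> n \<omega> \<partial>M) = \<mu>"
    and dev: "integrable M (\<lambda>\<omega>. (\<xi> n \<omega> - \<mu>)\<^sup>2)" "(\<integral>\<omega>. (\<xi> n \<omega> - \<mu>)\<^sup>2 \<partial>M) = \<sigma>\<^sup>2"
    using noise by (auto simp: channel_noise_def iid_def)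
  have sq: "(\<xi> n \<omega>)\<^sup>2 = (\<xi> n \<omega> - \<mu>)\<^sup>2 + (2 * \<mu> * \<xi> n \<omega> - \<mu>\<^sup>2)" for \<omega>
    by (simp add: power2_eq_square algebra_simps)
  have \<xi>2: "integrable M (\<lambda>\<omega>. (\<xi> n \<omega>)\<^sup>2)" "(\<integral>\<omega>. (\<xi> n \<omega>)\<^sup>2 \<partial>M) = s"
    unfolding sq using \<xi> dev by (simp_all add: prob_space s_def power2_eq_square)
  define q where "q S \<omega> = z n \<omega> \<bullet> (S *v z n \<omega>)" for S \<omega>
  have indep: "indep_var borel (\<xi> n) borel (q S)" for S
  proof -
    define g where "g x = (iterated_prod (\<lambda>j. A j + x j *\<^sub>R E j) n *v v)
        \<bullet> (S *v (iterated_prod (\<lambda>j. A j + x j *\<^sub>R E j) n *v v))" for x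
    have "indep_var borel ((\<lambda>x. x n) \<circ> (\<lambda>\<omega>. restrict (\<lambda>i. \<xi> i \<omega>) {n}))
        borel (g \<circ> (\<lambda>\<omega>. restrict (\<lambda>i. \<xi> i \<omega>) {..<n}))"
    proof (rule indep_var_compose[OF indep_var_restrict[OF ind]])
      show "g \<in> borel_measurable (Pi\<^sub>M {..<n} (\<lambda>_. borel))"
        unfolding g_def
        by (intro borel_measurable_inner borel_measurable_matrix_mult borel_measurable_iterated_prod order_refl)
    qed auto
    moreover have "(g \<circ> (\<lambda>\<omega>. restrict (\<lambda>i. \<xi> i \<omega>) {..<n})) = q S"
    proof
      fix \<omega>
      have "iterated_prod (\<lambda>j. A j + restrict (\<lambda>i. \<xi> i \<omega>) {..<n} j *\<^sub>R E j) n
          = iterated_prod (\<lambda>j. A j + \<xi> j \<omega> *\<^sub>R E j) n"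
        by (rule iterated_prod_cong) simp
      then show "(g \<circ> (\<lambda>\<omega>. restrict (\<lambda>i. \<xi> i \<omega>) {..<n})) \<omega> = q S \<omega>"
        by (simp add: g_def q_def z_def)
    qed
    ultimately show ?thesis by (simp add: o_def)
  qed
  have indep2: "indep_var borel (\<lambda>\<omega>. (\<xi> n \<omega>)\<^sup>2) borel (q S)" for S
  proof -
    have "indep_var borel ((\<lambda>x. x\<^sup>2) \<circ> \<xi> n) borel ((\<lambda>x. x) \<circ> q S)"
      by (rule indep_var_compose[OF indep]) auto
    then show ?thesis by (simp only: o_def)
  qed
  let ?S1 = "transpose (A n) ** P ** A n"
  let ?S2 = "transpose (A n) ** P ** E n + transpose (E n) ** P ** A n"
  let ?S3 = "transpose (E n) ** P ** E n"
  have sym: "transpose ?S1 = ?S1" "transpose ?S2 = ?S2" "transpose ?S3 = ?S3"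
    by (simp_all add: transpose_add matrix_transpose_mul Suc.prems matrix_mul_assoc add.commute)
  have int: "integrable M (q S)" if "transpose S = S" for S
    unfolding q_def using Suc.IH[OF that] by blast
  have expand: "z (Suc n) \<omega> \<bullet> (P *v z (Suc n) \<omega>)
      = q ?S1 \<omega> + (\<xi> n \<omega> * q ?S2 \<omega> + (\<xi> n \<omega>)\<^sup>2 * q ?S3 \<omega>)" for \<omega>
  proof -
    have "z (Suc n) \<omega> = A n *v z n \<omega> + \<xi> n \<omega> *\<^sub>R (E n *v z n \<omega>)"
      by (simp add: z_def iterated_prod_Suc matrix_vector_mul_assoc[symmetric]
          matrix_vector_mult_add_rdistrib scaleR_matrix_vector_assoc)
    then show ?thesis
      by (simp add: q_def matrix_vector_mult_add_rdistrib matrix_vector_right_distrib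
          matrix_vector_mult_scaleR inner_add_left inner_add_right inner_congruence
          power2_eq_square algebra_simps)
  qed
  have int2: "integrable M (\<lambda>\<omega>. \<xi> n \<omega> * q ?S2 \<omega>)"
    by (rule indep_var_integrable[OF indep \<xi>(1) int[OF sym(2)]])
  have int3: "integrable M (\<lambda>\<omega>. (\<xi> n \<omega>)\<^sup>2 * q ?S3 \<omega>)"
    by (rule indep_var_integrable[OF indep2 \<xi>2(1) int[OF sym(3)]])
  have step: "q (moment_step \<mu> s (A n) (E n) P) \<omega> = q ?S1 \<omega> + (\<mu> * q ?S2 \<omega> + s * q ?S3 \<omega>)" for \<omega>
    by (simp add: q_def moment_step_def matrix_vector_mult_add_rdistrib inner_add_right
        scaleR_matrix_vector_assoc[symmetric])
  have integrable: "integrable M (\<lambda>\<omega>. z (Suc n) \<omega> \<bullet> (P *v z (Suc n) \<omega>))"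
    unfolding expand by (intro Bochner_Integration.integrable_add int[OF sym(1)] int2 int3)
  have "(\<integral>\<omega>. z (Suc n) \<omega> \<bullet> (P *v z (Suc n) \<omega>) \<partial>M)
        = (\<integral>\<omega>. q ?S1 \<omega> \<partial>M) + (\<mu> * (\<integral>\<omega>. q ?S2 \<omega> \<partial>M) + s * (\<integral>\<omega>. q ?S3 \<omega> \<partial>M))"
    unfolding expand
    using int[OF sym(1)] int2 int3
      indep_var_lebesgue_integral[OF indep \<xi>(1) int[OF sym(2)]]
      indep_var_lebesgue_integral[OF indep2 \<xi>2(1) int[OF sym(3)]]
    by (simp add: \<xi>(2) \<xi>2(2))
  also have "\<dots> = (\<integral>\<omega>. q (moment_step \<mu> s (A n) (E n) P) \<omega> \<partial>M)"
    unfolding step using int[OF sym(1)] int[OF sym(2)] int[OF sym(3)] by simp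
  also have "\<dots> = v \<bullet> (iterated_moment \<mu> s A E (Suc n) P *v v)"
    unfolding q_def using Suc.IH[OF moment_step_symmetric[OF Suc.prems]] by (simp add: s_def)
  finally have "(\<integral>\<omega>. z (Suc n) \<omega> \<bullet> (P *v z (Suc n) \<omega>) \<partial>M)
    = v \<bullet> (iterated_moment \<mu> s A E (Suc n) P *v v)" .
  with integrable show ?case by (simp add: s_def)
qed

text \<open>What a bound on the second moments of the noisy product says about the noise-free product
  \<open>A (n - 1) \<cdots> A 0\<close>, whatever the feedback matrices \<open>C j\<close> are.\<close>

lemma mean_square_bound_imp:
  fixes A :: "nat \<Rightarrow> real^'n^'n" and B :: "real^'d^'n" and C :: "nat \<Rightarrow> real^'n^'d"
    and \<xi> :: "nat \<Rightarrow> 's \<Rightarrow> real"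
  assumes M: "prob_space M" and noise: "channel_noise M \<xi> \<mu> \<sigma>"
    and bound: "\<And>v. (\<integral>\<^sup>+\<omega>. ennreal ((norm (iterated_prod (\<lambda>j. A j + \<xi> j \<omega> *\<^sub>R (B ** C j)) n *v v))\<^sup>2) \<partial>M)
        \<le> ennreal (c * (norm v)\<^sup>2)"
    and c: "0 \<le> c"
  defines "r \<equiv> 1 - \<mu>\<^sup>2 / (\<mu>\<^sup>2 + \<sigma>\<^sup>2)"
  shows "r ^ n * (norm (iterated_prod A n *v v))\<^sup>2 \<le> c * (norm v)\<^sup>2"
    and "CARD('d) \<le> CARD('n) \<Longrightarrow> mat_less 0 (transpose B ** B) \<Longrightarrow>
      (r ^ CARD('d)) ^ n * (det (iterated_prod A n))\<^sup>2 \<le> c ^ CARD('n)"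
proof -
  let ?s = "\<mu>\<^sup>2 + \<sigma>\<^sup>2"
  let ?Q = "iterated_moment \<mu> ?s A (\<lambda>j. B ** C j) n (mat 1)"
  have "\<sigma>\<^sup>2 \<noteq> 0" using noise by (simp add: channel_noise_def)
  then have s: "?s > 0" and ms: "\<mu>\<^sup>2 < ?s" by (simp_all add: add_nonneg_pos)
  have one: "mat_less 0 (mat 1 :: real^'n^'n)" by (simp add: mat_less_0_iff)
  have le: "v \<bullet> (?Q *v v) \<le> c * (norm v)\<^sup>2" for v
  proof -
    let ?z = "\<lambda>\<omega>. iterated_prod (\<lambda>j. A j + \<xi> j \<omega> *\<^sub>R (B ** C j)) n *v v"
    note m = second_moment_iterated_prod[OF M noise, of "mat 1" A "\<lambda>j. B ** C j" n v, simplified]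
    have "ennreal (v \<bullet> (?Q *v v)) = ennreal (\<integral>\<omega>. ?z \<omega> \<bullet> ?z \<omega> \<partial>M)" by (simp add: m)
    also have "\<dots> = (\<integral>\<^sup>+\<omega>. ennreal (?z \<omega> \<bullet> ?z \<omega>) \<partial>M)"
      by (rule nn_integral_eq_integral[symmetric]) (simp_all add: m)
    also have "\<dots> \<le> ennreal (c * (norm v)\<^sup>2)" using bound[of v] by (simp add: power2_norm_eq_inner)
    finally show ?thesis using c by simp
  qed
  show "r ^ n * (norm (iterated_prod A n *v v))\<^sup>2 \<le> c * (norm v)\<^sup>2"
    using iterated_moment_ge[OF s order.strict_implies_order[OF ms] pos_def_imp_pos_semidef[OF one], of n A v "\<lambda>j. B ** C j"]
      le[of v] by (simp add: r_def power2_norm_eq_inner)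
  assume card: "CARD('d) \<le> CARD('n)" and B: "mat_less 0 (transpose B ** B)"
  show "(r ^ CARD('d)) ^ n * (det (iterated_prod A n))\<^sup>2 \<le> c ^ CARD('n)"
  proof (cases "\<forall>j<n. det (A j) \<noteq> 0")
    case True
    note Q = det_iterated_moment_ge[OF s ms, of n A B "mat 1" C] 
    have Qpos: "mat_less 0 ?Q" using Q True B card one by blast
    have "(r ^ CARD('d)) ^ n * (det (iterated_prod A n))\<^sup>2 \<le> det ?Q"
      using Q True B card one by (simp add: r_def)
    also have "\<dots> \<le> det (c *\<^sub>R (mat 1 :: real^'n^'n))"
      using le by (intro det_mono_pos_def[OF _ Qpos])
        (simp_all add: transpose_scalar power2_norm_eq_inner scaleR_matrix_vector_assoc[symmetric])
    also have "\<dots> = (\<Prod>i\<in>(UNIV::'n set). c)"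
      by (subst det_diagonal) (simp_all add: mat_def)
    finally show ?thesis by simp
  next
    \<comment> \<open>A singular factor makes the left-hand side vanish.\<close>
    case False
    then have "det (iterated_prod A n) = 0" by (auto simp: det_iterated_prod)
    then show ?thesis using c by simp
  qed
qed

section \<open>Linearisation of the closed loop along an orbit\<close>

lemma AE_lebesgue_imp_dense:
  fixes P :: "'a::euclidean_space \<Rightarrow> bool"
  assumes "AE x in lebesgue. P x"
  shows "closure {x. P x} = UNIV"
proof -
  from assms obtain N where N: "{x. \<not> P x} \<subseteq> N" "N \<in> null_sets lebesgue"
    by (auto simp: eventually_ae_filter)
  let ?U = "- closure {x. P x}"
  have "?U \<subseteq> N" using N(1) closure_subset[of "{x. P x}"] by blast
  then have "negligible ?U"
    using N(2) negligible_subset by (metis negligible_iff_null_sets)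
  then have "?U = {}"
    using open_not_negligible[of ?U] by auto
  then show ?thesis by blast
qed

text \<open>Fatou's lemma in the form used below: no domination is available, but upper bounds survive.\<close>

lemma nn_integral_limit_le:
  fixes u :: "nat \<Rightarrow> 'a \<Rightarrow> ennreal"
  assumes "\<And>i. u i \<in> borel_measurable M" and lim: "\<And>\<omega>. (\<lambda>i. u i \<omega>) \<longlonglongrightarrow> u' \<omega>"
    and le: "\<And>i. (\<integral>\<^sup>+\<omega>. u i \<omega> \<partial>M) \<le> c i" and c: "c \<longlonglongrightarrow> c'"
  shows "(\<integral>\<^sup>+\<omega>. u' \<omega> \<partial>M) \<le> c'"
proof -
  have "(\<integral>\<^sup>+\<omega>. u' \<omega> \<partial>M) = (\<integral>\<^sup>+\<omega>. liminf (\<lambda>i. u i \<omega>) \<partial>M)"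
    by (intro nn_integral_cong) (simp add: lim_imp_Liminf[OF _ lim])
  also have "\<dots> \<le> liminf (\<lambda>i. \<integral>\<^sup>+\<omega>. u i \<omega> \<partial>M)" by (rule nn_integral_liminf) fact
  also have "\<dots> \<le> liminf c" by (intro Liminf_mono always_eventually allI le)
  also have "\<dots> = c'" by (simp add: lim_imp_Liminf[OF _ c])
  finally show ?thesis .
qed

lemma continuous_on_closed_loop:
  assumes "continuous_on UNIV f" "continuous_on UNIV k"
  shows "continuous_on UNIV (\<lambda>x. closed_loop f B k w \<xi> \<gamma> x n)"
proof (induction n)
  case (Suc n)
  have B: "continuous_on UNIV (\<lambda>x. B *v x)"
    by (intro linear_continuous_on matrix_vector_mul_bounded_linear)
  show ?case unfolding closed_loop.simps Let_def
    by (intro continuous_intros continuous_on_compose2[OF assms(1) Suc] 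
        continuous_on_compose2[OF B] continuous_on_compose2[OF assms(2) Suc]) auto
qed (simp add: continuous_on_id)

lemma borel_measurable_closed_loop:
  assumes f: "continuous_on UNIV f" and k: "continuous_on UNIV k"
    and \<xi>: "\<And>j. \<xi> j \<in> borel_measurable M" and \<gamma>: "\<And>j. \<gamma> j \<in> borel_measurable M"
  shows "(\<lambda>\<omega>. closed_loop f B k w (\<lambda>j. \<xi> j \<omega>) (\<lambda>j. \<gamma> j \<omega>) x n) \<in> borel_measurable M"
proof (induction n)
  case (Suc n)
  show ?case unfolding closed_loop.simps Let_def
    by (intro borel_measurable_add borel_measurable_scaleR borel_measurable_matrix_mult \<xi> \<gamma>
        borel_measurable_continuous_on[OF f Suc] borel_measurable_continuous_on[OF k Suc]
        borel_measurable_const)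
qed simp

lemma borel_measurable_norm_square:
  fixes g :: "'s \<Rightarrow> real^'n"
  assumes "g \<in> borel_measurable M"
  shows "(\<lambda>\<omega>. ennreal ((norm (g \<omega>))\<^sup>2)) \<in> borel_measurable M"
  using assms by measurable

lemma incremental_bound_sym:
  "incremental_bound M f B k \<xi> \<gamma> K \<beta> x y \<longleftrightarrow> incremental_bound M f B k \<xi> \<gamma> K \<beta> y x"
  by (simp only: incremental_bound_def norm_minus_commute)

text \<open>For each realisation of the noise the trajectories depend continuously on the initial condition, so
  Fatou's lemma carries the bound to limits of initial conditions.\<close>

lemma incremental_bound_closure:
  fixes f :: "real^'n \<Rightarrow> real^'n"
  assumes f: "continuous_on UNIV f" and k: "continuous_on UNIV k"
    and \<xi>: "\<And>j. \<xi> j \<in> borel_measurable M" and \<gamma>: "\<And>j. \<gamma> j \<in> borel_measurable M"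
    and y: "y \<in> closure {y. incremental_bound M f B k \<xi> \<gamma> K \<beta> x y}"
  shows "incremental_bound M f B k \<xi> \<gamma> K \<beta> x y"
  unfolding incremental_bound_def
proof (intro allI)
  fix w n
  obtain Y where Y: "\<And>i. incremental_bound M f B k \<xi> \<gamma> K \<beta> x (Y i)" "Y \<longlonglongrightarrow> y"
    using y unfolding closure_sequential by auto
  let ?cl = "\<lambda>y \<omega>. closed_loop f B k w (\<lambda>j. \<xi> j \<omega>) (\<lambda>j. \<gamma> j \<omega>) y (Suc n)"
  have lim: "(\<lambda>i. ?cl (Y i) \<omega>) \<longlonglongrightarrow> ?cl y \<omega>" for \<omega>
    using continuous_on_tendsto_compose[OF continuous_on_closed_loop[OF f k] Y(2)]
    by (simp del: closed_loop.simps)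
  show "(\<integral>\<^sup>+\<omega>. ennreal ((norm (?cl x \<omega> - ?cl y \<omega>))\<^sup>2) \<partial>M) \<le> ennreal (K * \<beta> ^ n * (norm (x - y))\<^sup>2)"
  proof (rule nn_integral_limit_le)
    show "(\<lambda>\<omega>. ennreal ((norm (?cl x \<omega> - ?cl (Y i) \<omega>))\<^sup>2)) \<in> borel_measurable M" for i
      by (rule borel_measurable_norm_square) (intro borel_measurable_diff borel_measurable_closed_loop f k \<xi> \<gamma>)
    show "(\<lambda>i. ennreal ((norm (?cl x \<omega> - ?cl (Y i) \<omega>))\<^sup>2)) \<longlonglongrightarrow> ennreal ((norm (?cl x \<omega> - ?cl y \<omega>))\<^sup>2)" for \<omega>
      by (intro tendsto_intros lim)
    show "(\<integral>\<^sup>+\<omega>. ennreal ((norm (?cl x \<omega> - ?cl (Y i) \<omega>))\<^sup>2) \<partial>M) \<le> ennreal (K * \<beta> ^ n * (norm (x - Y i))\<^sup>2)" for i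
      using Y(1)[of i] unfolding incremental_bound_def by blast
    show "(\<lambda>i. ennreal (K * \<beta> ^ n * (norm (x - Y i))\<^sup>2)) \<longlonglongrightarrow> ennreal (K * \<beta> ^ n * (norm (x - y))\<^sup>2)"
      by (intro tendsto_intros Y(2))
  qed
qed

text \<open>Sets of full measure are dense, so the bound extends to all \<open>y\<close> and then, by symmetry, to all \<open>x\<close>.
  This is what makes particular orbits accessible, whether or not they are typical.\<close>

lemma incremental_bound_everywhere:
  fixes f :: "real^'n \<Rightarrow> real^'n"
  assumes f: "continuous_on UNIV f" and k: "continuous_on UNIV k"
    and \<xi>: "\<And>j. \<xi> j \<in> borel_measurable M" and \<gamma>: "\<And>j. \<gamma> j \<in> borel_measurable M"
    and ae: "AE x in lebesgue. AE y in lebesgue. incremental_bound M f B k \<xi> \<gamma> K \<beta> x y"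
  shows "incremental_bound M f B k \<xi> \<gamma> K \<beta> x y"
proof -
  note closure = incremental_bound_closure[where f=f and k=k and \<xi>=\<xi> and \<gamma>=\<gamma>, OF f k \<xi> \<gamma>]
  have "AE x in lebesgue. \<forall>y. incremental_bound M f B k \<xi> \<gamma> K \<beta> x y"
    using ae
  proof eventually_elim
    case (elim x)
    then show ?case by (intro allI closure) (simp add: AE_lebesgue_imp_dense)
  qed
  then have "AE x in lebesgue. incremental_bound M f B k \<xi> \<gamma> K \<beta> y x" for y
    by eventually_elim (simp only: incremental_bound_sym[of M f B k \<xi> \<gamma> K \<beta> y])
  then have "incremental_bound M f B k \<xi> \<gamma> K \<beta> y x"
    by (intro closure) (simp add: AE_lebesgue_imp_dense)
  then show ?thesis by (simp only: incremental_bound_sym[of M f B k \<xi> \<gamma> K \<beta> x])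
qed

lemma C1_map_has_derivative: "C1_map g \<Longrightarrow> (g has_derivative (\<lambda>h. Jac g x *v h)) (at x)"
  unfolding C1_map_def jacobian_works by blast

lemma C1_map_continuous: "C1_map g \<Longrightarrow> continuous_on UNIV g"
  unfolding C1_map_def
  by (intro continuous_at_imp_continuous_on ballI differentiable_imp_continuous_within) blast

text \<open>The input \<open>- k (x j)\<close> annihilates everything that is multiplied by the channel noise.\<close>

lemma closed_loop_cancelling_input:
  "closed_loop f B k (\<lambda>j. - k ((f ^^ j) x)) \<xi> (\<lambda>_. 0) x n = (f ^^ n) x"
proof (induction n)
  case (Suc n)
  have "B *v (- k z) = - (B *v k z)" for z
    by (rule linear_neg[OF matrix_vector_mul_linear])
  then show ?case by (simp add: Suc Let_def)
qed simp

lemma closed_loop_has_derivative: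
  fixes f :: "real^'n \<Rightarrow> real^'n" and B :: "real^'d^'n"
  assumes f: "C1_map f" and k: "C1_map k"
  shows "((\<lambda>y. closed_loop f B k (\<lambda>j. - k ((f ^^ j) x)) \<xi> (\<lambda>_. 0) y n) has_derivative
    (\<lambda>h. iterated_prod (\<lambda>j. Jac f ((f ^^ j) x) + \<xi> j *\<^sub>R (B ** Jac k ((f ^^ j) x))) n *v h)) (at x)"
proof (induction n)
  case (Suc n)
  let ?z = "(f ^^ n) x"
  let ?g = "\<lambda>z. f z + \<xi> n *\<^sub>R (B *v k z) + \<xi> n *\<^sub>R (B *v (- k ?z)) + 0"
  let ?D = "Jac f ?z + \<xi> n *\<^sub>R (B ** Jac k ?z)"
  let ?cl = "\<lambda>y. closed_loop f B k (\<lambda>j. - k ((f ^^ j) x)) \<xi> (\<lambda>_. 0) y n"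
  have Bk: "((\<lambda>z. B *v k z) has_derivative (\<lambda>h. B *v (Jac k ?z *v h))) (at ?z)"
    by (rule bounded_linear.has_derivative[OF matrix_vector_mul_bounded_linear C1_map_has_derivative[OF k]])
  have "(?g has_derivative (\<lambda>h. Jac f ?z *v h + \<xi> n *\<^sub>R (B *v (Jac k ?z *v h)) + 0 + 0)) (at ?z)"
    by (intro has_derivative_add has_derivative_const has_derivative_scaleR_right Bk C1_map_has_derivative[OF f])
  also have "(\<lambda>h. Jac f ?z *v h + \<xi> n *\<^sub>R (B *v (Jac k ?z *v h)) + 0 + 0) = (\<lambda>h. ?D *v h)"
    by (simp add: fun_eq_iff matrix_vector_mult_add_rdistrib matrix_vector_mul_assoc scaleR_matrix_vector_assoc)
  finally have "(?g has_derivative (\<lambda>h. ?D *v h)) (at (?cl x))"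
    by (simp only: closed_loop_cancelling_input)
  from has_derivative_compose[OF Suc this] show ?case
    by (simp add: Let_def iterated_prod_Suc matrix_vector_mul_assoc)
qed simp

lemma has_derivative_difference_quotient:
  fixes F :: "'a::real_normed_vector \<Rightarrow> 'b::real_normed_vector"
  assumes F: "(F has_derivative D) (at x)"
  shows "(\<lambda>i. real (Suc i) *\<^sub>R (F (x + (1 / real (Suc i)) *\<^sub>R v) - F x)) \<longlonglongrightarrow> D v"
proof -
  interpret D: bounded_linear D using F by (rule has_derivative_bounded_linear)
  have "((\<lambda>t::real. x + t *\<^sub>R v) has_derivative (\<lambda>t. t *\<^sub>R v)) (at 0)"
    by (auto intro!: derivative_eq_intros)
  moreover have "(F has_derivative D) (at (x + 0 *\<^sub>R v))" using F by simp
  ultimately have "((\<lambda>t. F (x + t *\<^sub>R v)) has_derivative (\<lambda>t. D (t *\<^sub>R v))) (at 0)"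
    by (rule has_derivative_compose)
  then have lim: "(\<lambda>t. norm (F (x + t *\<^sub>R v) - F x - t *\<^sub>R D v) / \<bar>t\<bar>) \<midarrow>0\<rightarrow> 0"
    by (simp add: has_derivative_at D.scaleR)
  have eq: "norm (F (x + t *\<^sub>R v) - F x - t *\<^sub>R D v) / \<bar>t\<bar>
      = norm ((1 / t) *\<^sub>R (F (x + t *\<^sub>R v) - F x) - D v)" if "t \<noteq> 0" for t :: real
  proof -
    have "(1 / t) *\<^sub>R (F (x + t *\<^sub>R v) - F x) - D v = (1 / t) *\<^sub>R (F (x + t *\<^sub>R v) - F x - t *\<^sub>R D v)"
      using that by (simp add: scaleR_diff_right)
    then show ?thesis by simp
  qed
  have "(\<lambda>t. norm ((1 / t) *\<^sub>R (F (x + t *\<^sub>R v) - F x) - D v)) \<midarrow>0\<rightarrow> 0"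
    by (rule Lim_transform_eventually[OF lim])
       (auto simp only: eventually_at_filter intro!: always_eventually eq)
  then have "(\<lambda>t. (1 / t) *\<^sub>R (F (x + t *\<^sub>R v) - F x)) \<midarrow>0\<rightarrow> D v"
    by (rule LIM_zero_cancel[OF tendsto_norm_zero_cancel])
  moreover have "filterlim (\<lambda>i. 1 / real (Suc i)) (at 0) sequentially"
    using LIMSEQ_inverse_real_of_nat unfolding inverse_eq_divide by (intro filterlim_atI) simp_all
  ultimately have "(\<lambda>i. (1 / (1 / real (Suc i))) *\<^sub>R (F (x + (1 / real (Suc i)) *\<^sub>R v) - F x)) \<longlonglongrightarrow> D v"
    by (rule filterlim_compose)
  then show ?thesis by (simp del: of_nat_Suc)
qed

text \<open>The incremental bound between \<open>x\<close> and \<open>x + v / i\<close>, multiplied by \<open>i\<^sup>2\<close>, no longer depends on \<open>i\<close>; the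
  difference quotients converge to the derivative of the flow along the orbit of \<open>x\<close>.\<close>

lemma linearised_mean_square_bound:
  fixes f :: "real^'n \<Rightarrow> real^'n" and B :: "real^'d^'n" and \<xi> :: "nat \<Rightarrow> 's \<Rightarrow> real"
  assumes f: "C1_map f" and k: "C1_map k" and \<xi>: "\<And>j. \<xi> j \<in> borel_measurable M"
    and bound: "\<And>y. incremental_bound M f B k \<xi> (\<lambda>_ _. 0) K \<beta> x y"
    and pos: "K > 0" "\<beta> > 0"
  shows "(\<integral>\<^sup>+\<omega>. ennreal ((norm (iterated_prod (\<lambda>j. Jac f ((f ^^ j) x) + \<xi> j \<omega> *\<^sub>R (B ** Jac k ((f ^^ j) x))) (Suc n) *v v))\<^sup>2) \<partial>M)
    \<le> ennreal (K * \<beta> ^ n * (norm v)\<^sup>2)"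
proof -
  let ?cl = "\<lambda>y \<omega>. closed_loop f B k (\<lambda>j. - k ((f ^^ j) x)) (\<lambda>j. \<xi> j \<omega>) (\<lambda>_. 0) y (Suc n)"
  let ?y = "\<lambda>i. x + (1 / real (Suc i)) *\<^sub>R v"
  let ?q = "\<lambda>i \<omega>. real (Suc i) *\<^sub>R (?cl (?y i) \<omega> - ?cl x \<omega>)"
  have cont: "continuous_on UNIV f" "continuous_on UNIV k" using f k by (simp_all add: C1_map_continuous)
  have meas: "?cl y \<in> borel_measurable M" for y
    by (rule borel_measurable_closed_loop[OF cont, where \<xi>=\<xi> and \<gamma>="\<lambda>_ _. 0"]) (simp_all add: \<xi>)
  show ?thesis
  proof (rule nn_integral_limit_le)
    show "(\<lambda>\<omega>. ennreal ((norm (?q i \<omega>))\<^sup>2)) \<in> borel_measurable M" for i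
      by (rule borel_measurable_norm_square) (intro borel_measurable_scaleR borel_measurable_const borel_measurable_diff meas)
    show "(\<lambda>i. ennreal ((norm (?q i \<omega>))\<^sup>2)) \<longlonglongrightarrow>
      ennreal ((norm (iterated_prod (\<lambda>j. Jac f ((f ^^ j) x) + \<xi> j \<omega> *\<^sub>R (B ** Jac k ((f ^^ j) x))) (Suc n) *v v))\<^sup>2)" for \<omega>
      by (intro tendsto_ennrealI tendsto_power tendsto_norm
          has_derivative_difference_quotient[OF closed_loop_has_derivative[OF f k]])
    show "(\<integral>\<^sup>+\<omega>. ennreal ((norm (?q i \<omega>))\<^sup>2) \<partial>M) \<le> ennreal (K * \<beta> ^ n * (norm v)\<^sup>2)" for i
    proof -
      have "ennreal ((norm (?q i \<omega>))\<^sup>2) = ennreal ((real (Suc i))\<^sup>2) * ennreal ((norm (?cl x \<omega> - ?cl (?y i) \<omega>))\<^sup>2)" for \<omega>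
        by (simp add: norm_minus_commute power_mult_distrib ennreal_mult'[symmetric] del: of_nat_Suc closed_loop.simps)
      then have "(\<integral>\<^sup>+\<omega>. ennreal ((norm (?q i \<omega>))\<^sup>2) \<partial>M)
          = ennreal ((real (Suc i))\<^sup>2) * (\<integral>\<^sup>+\<omega>. ennreal ((norm (?cl x \<omega> - ?cl (?y i) \<omega>))\<^sup>2) \<partial>M)"
        using meas by (simp add: nn_integral_cmult del: of_nat_Suc closed_loop.simps)
      also have "\<dots> \<le> ennreal ((real (Suc i))\<^sup>2) * ennreal (K * \<beta> ^ n * (norm (x - ?y i))\<^sup>2)"
      proof (rule mult_left_mono)
        show "(\<integral>\<^sup>+\<omega>. ennreal ((norm (?cl x \<omega> - ?cl (?y i) \<omega>))\<^sup>2) \<partial>M) \<le> ennreal (K * \<beta> ^ n * (norm (x - ?y i))\<^sup>2)"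
          using bound[of "?y i"] unfolding incremental_bound_def by blast
      qed simp
      also have "\<dots> = ennreal (K * \<beta> ^ n * (norm v)\<^sup>2)"
        using pos by (simp add: ennreal_mult'[symmetric] power_mult_distrib power_divide del: of_nat_Suc)
      finally show ?thesis .
    qed
  qed simp
qed

section \<open>Exponential growth rates\<close>

text \<open>Comparison of exponential rates when the base on the left-hand side varies with \<open>n\<close> and converges.
  The constants \<open>c\<close> and \<open>K\<close> do not affect the rate; they absorb the mismatch between the \<open>n\<close>-th
  root and the \<open>n + 1\<close> factors of the transition matrix.\<close>

lemma geometric_dominated_limit:
  fixes a :: "nat \<Rightarrow> real"
  assumes a: "a \<longlonglongrightarrow> l" and b: "0 < b"
    and bound: "\<And>n. n > 0 \<Longrightarrow> c * a n ^ n \<le> K * b ^ n" and c: "0 < c"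
  shows "l \<le> b"
proof (rule ccontr)
  assume "\<not> l \<le> b"
  then obtain q where q: "b < q" "q < l" using dense[of b l] by auto
  have "eventually (\<lambda>n. q < a n) sequentially" using a q(2) by (rule order_tendstoD)
  moreover have "(\<lambda>n. (K / c) / (q / b) ^ n) \<longlonglongrightarrow> 0"
    using q b by (intro LIMSEQ_divide_realpow_zero) simp
  then have "eventually (\<lambda>n. (K / c) / (q / b) ^ n < 1) sequentially"
    by (rule order_tendstoD) simp
  then have "eventually (\<lambda>n. K / c < (q / b) ^ n) sequentially"
    by eventually_elim (use q b in \<open>simp only: pos_divide_less_eq zero_less_power divide_pos_pos mult_1\<close>)
  ultimately have "eventually (\<lambda>n. q < a n \<and> K / c < (q / b) ^ n \<and> 0 < n) sequentially"
    using eventually_gt_at_top[of 0] by eventually_elim simp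
  then obtain n where n: "q < a n" "K / c < (q / b) ^ n" "0 < n"
    using eventually_happens'[OF sequentially_bot] by blast
  have "K * b ^ n < c * q ^ n"
    using n(2) b c by (simp add: field_simps power_divide)
  also have "\<dots> \<le> c * a n ^ n"
    using n(1) q b c by (intro mult_left_mono power_mono) auto
  finally show False using bound[OF n(3)] by simp
qed

lemma mat_power_0 [simp]: "mat_power R 0 = mat 1"
  and mat_power_Suc: "mat_power R (Suc p) = R ** mat_power R p"
  by (simp_all add: mat_power_def)

lemma det_mat_power: "det (mat_power R p) = det R ^ p"
  by (induction p) (simp_all add: mat_power_Suc det_mul)

lemma mat_power_add: "mat_power R (p + q) = mat_power R p ** mat_power R q"
  by (induction p) (simp_all add: mat_power_Suc matrix_mul_assoc)

lemma transpose_mat_power: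
  assumes "transpose R = R"
  shows "transpose (mat_power R p) = mat_power R p"
proof (induction p)
  case (Suc p)
  have "transpose (mat_power R (Suc p)) = mat_power R p ** mat_power R 1"
    by (simp add: mat_power_Suc matrix_transpose_mul Suc assms)
  also have "\<dots> = mat_power R (Suc p)" using mat_power_add[of R p 1] by simp
  finally show ?case .
qed simp

text \<open>The sequence \<open>\<parallel>R ^ p u\<parallel>\<close> is logarithmically convex by the Cauchy-Schwarz inequality, so its successive
  ratios increase from the first one, \<open>\<parallel>R u\<parallel>\<close>.\<close>

lemma norm_mat_power_ge:
  fixes R :: "real^'n^'n"
  assumes R: "transpose R = R" and u: "norm u = 1"
  shows "norm (R *v u) ^ p \<le> norm (mat_power R p *v u)"
proof -
  define a where "a p = norm (mat_power R p *v u)" for p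
  have step: "mat_power R (Suc p) *v u = R *v (mat_power R p *v u)" for p
    by (simp add: mat_power_Suc matrix_vector_mul_assoc)
  have log_convex: "(a (Suc p))\<^sup>2 \<le> a p * a (Suc (Suc p))" for p
  proof -
    have "(a (Suc p))\<^sup>2 = (mat_power R p *v u) \<bullet> (mat_power R (Suc (Suc p)) *v u)"
      using inner_symmetric_mult[OF R, of "mat_power R p *v u" "mat_power R (Suc p) *v u"]
      by (simp add: a_def power2_norm_eq_inner step)
    also have "\<dots> \<le> a p * a (Suc (Suc p))" unfolding a_def by (rule norm_cauchy_schwarz)
    finally show ?thesis .
  qed
  have nonneg: "0 \<le> a p" for p by (simp add: a_def)
  have ratio: "a 1 * a p \<le> a (Suc p)" for p
  proof (induction p)
    case 0 then show ?case by (simp add: a_def u)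
  next
    case (Suc p)
    show ?case
    proof (cases "a (Suc p) = 0")
      case False
      have "a 1 * a (Suc p) * a (Suc p) \<le> a 1 * (a p * a (Suc (Suc p)))"
        using mult_left_mono[OF log_convex[of p] nonneg[of 1]] by (simp add: power2_eq_square mult_ac)
      also have "\<dots> \<le> a (Suc (Suc p)) * a (Suc p)"
        using mult_right_mono[OF Suc.IH nonneg[of "Suc (Suc p)"]] by (simp add: mult_ac)
      finally show ?thesis using False nonneg[of "Suc p"] by simp
    qed (simp add: nonneg)
  qed
  have "a 1 ^ p \<le> a p"
  proof (induction p)
    case 0 then show ?case by (simp add: a_def u)
  next
    case (Suc p)
    have "a 1 ^ Suc p \<le> a 1 * a p" using mult_left_mono[OF Suc.IH nonneg[of 1]] by simp
    also note ratio
    finally show ?case .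
  qed
  then show ?thesis by (simp add: a_def mat_power_Suc)
qed

text \<open>\<open>A\<close> acts on the pair \<open>(a, b)\<close> as multiplication of \<open>a + \<i> b\<close> by \<open>x + \<i> y\<close>, which scales the complex norm.\<close>

lemma norm_eigenpair_growth:
  fixes A :: "real^'n^'n"
  assumes "A *v a = x *\<^sub>R a - y *\<^sub>R b" "A *v b = y *\<^sub>R a + x *\<^sub>R b"
  shows "(norm (mat_power A p *v a))\<^sup>2 + (norm (mat_power A p *v b))\<^sup>2
    = (x\<^sup>2 + y\<^sup>2) ^ p * ((norm a)\<^sup>2 + (norm b)\<^sup>2)"
proof (induction p)
  case (Suc p)
  let ?a = "mat_power A p *v a" and ?b = "mat_power A p *v b"
  have comm: "mat_power A (Suc p) *v c = mat_power A p *v (A *v c)" for c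
    using mat_power_add[of A p 1] by (simp add: mat_power_Suc matrix_vector_mul_assoc)
  have a: "mat_power A (Suc p) *v a = x *\<^sub>R ?a - y *\<^sub>R ?b"
    and b: "mat_power A (Suc p) *v b = y *\<^sub>R ?a + x *\<^sub>R ?b"
    by (simp_all add: comm assms matrix_vector_mult_diff_distrib matrix_vector_right_distrib
        matrix_vector_mult_scaleR)
  have "(norm (mat_power A (Suc p) *v a))\<^sup>2 + (norm (mat_power A (Suc p) *v b))\<^sup>2
      = (x\<^sup>2 + y\<^sup>2) * ((norm ?a)\<^sup>2 + (norm ?b)\<^sup>2)"
    unfolding a b power2_norm_eq_inner
    by (simp add: inner_add_left inner_add_right inner_diff_left inner_diff_right inner_commute[of ?b ?a])
       (simp add: algebra_simps power2_eq_square)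
  then show ?case by (simp add: Suc)
qed simp

lemma iterated_prod_const: "iterated_prod (\<lambda>_. A) n = mat_power A n"
  by (induction n) (simp_all add: iterated_prod_Suc mat_power_Suc)

lemma transition_matrix_iterated_prod:
  "transition_matrix f x n 0 = iterated_prod (\<lambda>j. Jac f ((f ^^ j) x)) (Suc n)"
  by (simp add: transition_matrix_def mat_prod_def iterated_prod_def)

text \<open>By definition of the roots \<open>R n\<close> converging to \<open>L\<close>, the squared determinant of the transition matrix is
  \<open>det (R n) ^ (2 n)\<close>.\<close>

lemma det_growth_bound:
  fixes f :: "real^'n \<Rightarrow> real^'n"
  assumes L: "lyapunov_matrix f x L" and r: "0 < r" and b: "0 < b"
    and bound: "\<And>n. r ^ Suc n * (det (transition_matrix f x n 0))\<^sup>2 \<le> K * b ^ n"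
  shows "r * (det L)\<^sup>2 \<le> b"
proof -
  from L obtain R where root: "\<And>n. n > 0 \<Longrightarrow> is_psd_root (2 * n)
      (transpose (transition_matrix f x n 0) ** transition_matrix f x n 0) (R n)"
    and R: "R \<longlonglongrightarrow> L" unfolding lyapunov_matrix_def by blast
  show ?thesis
  proof (rule geometric_dominated_limit[OF _ b _ r])
    show "(\<lambda>n. r * (det (R n))\<^sup>2) \<longlonglongrightarrow> r * (det L)\<^sup>2"
      by (intro tendsto_intros tendsto_det R)
    show "r * (r * (det (R n))\<^sup>2) ^ n \<le> K * b ^ n" if "n > 0" for n
    proof -
      let ?Q = "transition_matrix f x n 0"
      have "det (R n) ^ (2 * n) = det (mat_power (R n) (2 * n))" by (simp add: det_mat_power)
      also have "\<dots> = det (transpose ?Q ** ?Q)"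
        using root[OF that] by (simp add: is_psd_root_def)
      also have "\<dots> = (det ?Q)\<^sup>2" by (simp add: det_mul power2_eq_square)
      finally have "(det (R n))\<^sup>2 ^ n = (det ?Q)\<^sup>2" by (simp only: power_mult)
      then show ?thesis using bound[of n] by (simp only: power_mult_distrib power_Suc mult_ac)
    qed
  qed
qed

text \<open>The squared norm of the image of \<open>u\<close> under the transition matrix is \<open>\<parallel>R n ^ n u\<parallel>\<^sup>2\<close>, which is at
  least \<open>\<parallel>R n u\<parallel> ^ (2 n)\<close>. So the fixed vector \<open>u\<close> can be used for all \<open>n\<close>, although the eigenvectors of
  \<open>R n\<close> vary.\<close>

lemma norm_growth_bound:
  fixes f :: "real^'n \<Rightarrow> real^'n"
  assumes L: "lyapunov_matrix f x L" and r: "0 < r" and b: "0 < b"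
    and bound: "\<And>n v. r ^ Suc n * (norm (transition_matrix f x n 0 *v v))\<^sup>2 \<le> K * b ^ n * (norm v)\<^sup>2"
    and u: "norm u = 1"
  shows "r * (norm (L *v u))\<^sup>2 \<le> b"
proof -
  from L obtain R where root: "\<And>n. n > 0 \<Longrightarrow> is_psd_root (2 * n)
      (transpose (transition_matrix f x n 0) ** transition_matrix f x n 0) (R n)"
    and R: "R \<longlonglongrightarrow> L" unfolding lyapunov_matrix_def by blast
  have Ru: "(\<lambda>n. R n *v u) \<longlonglongrightarrow> L *v u"
    unfolding matrix_vector_mult_def by (intro tendsto_vec_lambda tendsto_intros R)
  show ?thesis
  proof (rule geometric_dominated_limit[OF _ b _ r])
    show "(\<lambda>n. r * (norm (R n *v u))\<^sup>2) \<longlonglongrightarrow> r * (norm (L *v u))\<^sup>2"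
      by (intro tendsto_intros Ru)
    show "r * (r * (norm (R n *v u))\<^sup>2) ^ n \<le> K * b ^ n" if n: "n > 0" for n
    proof -
      let ?Q = "transition_matrix f x n 0" and ?T = "mat_power (R n) n"
      have sym: "transpose (R n) = R n" and pow: "mat_power (R n) (2 * n) = transpose ?Q ** ?Q"
        using root[OF n] by (simp_all add: is_psd_root_def mat_le_0_iff)
      have "(norm (R n *v u) ^ n)\<^sup>2 \<le> (norm (?T *v u))\<^sup>2"
        by (intro power_mono norm_mat_power_ge[OF sym u]) simp
      also have "\<dots> = u \<bullet> (mat_power (R n) (2 * n) *v u)"
        using inner_transpose_mult[of u ?T "?T *v u"] transpose_mat_power[OF sym, of n]
        by (simp add: mult_2 mat_power_add matrix_vector_mul_assoc power2_norm_eq_inner)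
      also have "\<dots> = (norm (?Q *v u))\<^sup>2"
        using inner_transpose_mult[of u ?Q "?Q *v u"] 
        by (simp add: pow matrix_vector_mul_assoc[symmetric] power2_norm_eq_inner)
      finally have "r ^ Suc n * (norm (R n *v u) ^ n)\<^sup>2 \<le> r ^ Suc n * (norm (?Q *v u))\<^sup>2"
        using r by (intro mult_left_mono) auto
      also have "\<dots> \<le> K * b ^ n" using bound[of n u] u by simp
      finally show ?thesis
        by (simp add: power_mult_distrib power_mult[symmetric] mult_ac)
    qed
  qed
qed

section \<open>Necessary conditions for stability\<close>

theorem theorem5p8:
  fixes M :: "'s measure"
    and f :: "real^'n \<Rightarrow> real^'n" and B :: "real^'d^'n" and k :: "real^'n \<Rightarrow> real^'d"
    and \<xi> :: "nat \<Rightarrow> 's \<Rightarrow> real" and \<gamma> :: "nat \<Rightarrow> 's \<Rightarrow> real^'n"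
    and \<mu> \<sigma> C \<rho> \<rho>bar :: real
    and Lam lam_exp :: "'n \<Rightarrow> real" and lam0 :: "'n \<Rightarrow> complex" and i1 imax :: 'n
  assumes "prob_space M"
    and "channel_noise M \<xi> \<mu> \<sigma>"
    and "additive_noise M \<gamma> C"
    and "unstable_plant f B"
    and "uniformly_controllable f B"
    and "admissible_controller f B \<mu> k"
    and "positive_lyapunov_dynamics f Lam"
    and "\<rho> = \<mu>\<^sup>2 / (\<mu>\<^sup>2 + \<sigma>\<^sup>2)" and "\<rho>bar = 1 - \<rho>"
    and "\<forall>i. lam_exp i = exp (Lam i)" and "\<forall>i. Lam i \<le> Lam i1"
    and "eigenvalues (Jac f 0) = image_mset lam0 (mset_set UNIV)"
    and "\<forall>i. cmod (lam0 i) \<le> cmod (lam0 imax)"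
    and "ms_exp_incrementally_stable M f B k \<xi> \<gamma>"
  shows "(1 \<le> CARD('d) \<and> CARD('d) < CARD('n) \<longrightarrow>
            \<rho>bar ^ CARD('d) *
              max (\<Prod>i\<in>UNIV. (lam_exp i)\<^sup>2) (\<Prod>i\<in>UNIV. (cmod (lam0 i))\<^sup>2) < 1) \<and>
         (CARD('d) = CARD('n) \<longrightarrow>
            \<rho>bar * max ((lam_exp i1)\<^sup>2) ((cmod (lam0 imax))\<^sup>2) < 1)"
proof -
  note M = assms(1) and noise = assms(2)
  have f: "C1_map f" and B: "mat_less 0 (transpose B ** B)" and f0: "f 0 = 0"
    using assms(4) by (auto simp: unstable_plant_def)
  have k: "C1_map k" using assms(6) by (simp add: admissible_controller_def)
  have \<xi>: "\<xi> j \<in> borel_measurable M" for j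
    using noise by (auto simp: channel_noise_def)
  have r_eq: "\<rho>bar = 1 - \<mu>\<^sup>2 / (\<mu>\<^sup>2 + \<sigma>\<^sup>2)" using assms(8,9) by simp
  have "\<sigma>\<^sup>2 \<noteq> 0" using noise by (simp add: channel_noise_def)
  then have r: "0 < \<rho>bar" unfolding r_eq by (simp add: add_nonneg_pos)
  from assms(14) obtain K \<beta> where K: "K > 0" and \<beta>: "0 < \<beta>" "\<beta> < 1"
    and "AE x in lebesgue. AE y in lebesgue. incremental_bound M f B k \<xi> (\<lambda>_ _. 0) K \<beta> x y"
    unfolding ms_exp_incrementally_stable_def by blast
  then have bound: "incremental_bound M f B k \<xi> (\<lambda>_ _. 0) K \<beta> x y" for x y
    by (intro incremental_bound_everywhere C1_map_continuous f k \<xi>) simp_all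
  have Kb: "0 \<le> K * \<beta> ^ n" for n using K \<beta> by simp
  note mean_square = mean_square_bound_imp[OF M noise linearised_mean_square_bound[OF f k \<xi> bound K \<beta>(1)] Kb]
  have norm_bound: "\<rho>bar ^ Suc n * (norm (transition_matrix f x n 0 *v v))\<^sup>2 \<le> K * \<beta> ^ n * (norm v)\<^sup>2" for x n v
    using mean_square(1)[of n x v] unfolding r_eq transition_matrix_iterated_prod .
  have det_bound: "(\<rho>bar ^ CARD('d)) ^ Suc n * (det (transition_matrix f x n 0))\<^sup>2
      \<le> K ^ CARD('n) * (\<beta> ^ CARD('n)) ^ n" if "CARD('d) \<le> CARD('n)" for x n
    using mean_square(2)[of n x, OF that B] unfolding r_eq transition_matrix_iterated_prod
    by (simp add: power_mult_distrib power_mult[symmetric] mult.commute)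
  have \<beta>N: "0 < \<beta> ^ CARD('n)" "\<beta> ^ CARD('n) < 1"
    using \<beta> by (simp_all add: power_less_one_iff)
  \<comment> \<open>A single typical initial condition suffices.\<close>
  have "AE x in lebesgue. lyapunov_exponents f x Lam"
    using assms(7) by (simp add: positive_lyapunov_dynamics_def)
  then have "closure {x. lyapunov_exponents f x Lam} = UNIV" by (rule AE_lebesgue_imp_dense)
  then obtain x where "lyapunov_exponents f x Lam" by (metis closure_empty empty_Collect_eq UNIV_not_empty)
  then obtain L lam where L: "lyapunov_matrix f x L"
    and eigL: "eigenvalues L = image_mset (\<lambda>i. complex_of_real (lam i)) (mset_set UNIV)"
    and lam: "\<And>i. 0 < lam i" "\<And>i. Lam i = ln (lam i)"
    unfolding lyapunov_exponents_def by auto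
  have lam_exp: "lam_exp i = lam i" for i using lam assms(10) by simp
  have transition0: "transition_matrix f 0 n 0 = mat_power (Jac f 0) (Suc n)" for n
  proof -
    have "(f ^^ j) 0 = 0" for j by (induction j) (simp_all add: f0)
    then show ?thesis by (simp add: transition_matrix_iterated_prod iterated_prod_const)
  qed
  have part1: "\<rho>bar ^ CARD('d) * max (\<Prod>i\<in>UNIV. (lam_exp i)\<^sup>2) (\<Prod>i\<in>UNIV. (cmod (lam0 i))\<^sup>2) < 1"
    if card: "CARD('d) \<le> CARD('n)"
  proof -
    have "complex_of_real (det L) = (\<Prod>i\<in>UNIV. complex_of_real (lam i))"
      using det_eq_prod_eigenvalues[of L] by (simp add: eigL prod_unfold_prod_mset)
    then have "complex_of_real (det L) = complex_of_real (\<Prod>i\<in>UNIV. lam i)" by simp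
    then have detL: "(det L)\<^sup>2 = (\<Prod>i\<in>UNIV. (lam_exp i)\<^sup>2)"
      by (simp only: of_real_eq_iff lam_exp prod_power_distrib)
    have "\<rho>bar ^ CARD('d) * (det L)\<^sup>2 \<le> \<beta> ^ CARD('n)"
      by (rule det_growth_bound[OF L _ \<beta>N(1) det_bound[OF card]]) (simp add: r)
    moreover have "\<rho>bar ^ CARD('d) * (det (Jac f 0))\<^sup>2 \<le> \<beta> ^ CARD('n)"
    proof -
      let ?g = "\<rho>bar ^ CARD('d) * (det (Jac f 0))\<^sup>2"
      have "det (Jac f 0) \<noteq> 0" using assms(4) by (simp add: unstable_plant_def invertible_det_nz)
      then have g: "?g > 0" using r by simp
      have "?g * ?g ^ n \<le> K ^ CARD('n) * (\<beta> ^ CARD('n)) ^ n" for n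
      proof -
        have "?g * ?g ^ n = (\<rho>bar ^ CARD('d)) ^ Suc n * ((det (Jac f 0))\<^sup>2) ^ Suc n"
          by (simp only: power_mult_distrib power_Suc mult_ac)
        also have "\<dots> = (\<rho>bar ^ CARD('d)) ^ Suc n * (det (transition_matrix f 0 n 0))\<^sup>2"
          by (simp only: transition0 det_mat_power power_mult[symmetric] mult.commute)
        finally show ?thesis using det_bound[OF card, of n 0] by (simp only:)
      qed
      then show ?thesis by (intro geometric_dominated_limit[OF tendsto_const \<beta>N(1) _ g])
    qed
    moreover have "(det (Jac f 0))\<^sup>2 = (\<Prod>i\<in>UNIV. (cmod (lam0 i))\<^sup>2)"
    proof -
      have "\<bar>det (Jac f 0)\<bar> = cmod (complex_of_real (det (Jac f 0)))" by simp
      also have "\<dots> = (\<Prod>i\<in>UNIV. cmod (lam0 i))"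
        by (simp only: det_eq_prod_eigenvalues assms(12) prod_unfold_prod_mset[symmetric] prod_norm[symmetric])
      finally show ?thesis by (metis power2_abs prod_power_distrib)
    qed
    ultimately show ?thesis using \<beta>N(2) detL by (auto simp: max_def)
  qed
  have part2: "\<rho>bar * max ((lam_exp i1)\<^sup>2) ((cmod (lam0 imax))\<^sup>2) < 1"
  proof -
    have "\<rho>bar * (lam_exp i1)\<^sup>2 \<le> \<beta>"
    proof -
      have "complex_of_real (lam i1) \<in># eigenvalues L" by (simp add: eigL)
      from eigenvalue_real_pair[OF this] obtain c where c: "c \<noteq> 0" "L *v c = lam i1 *\<^sub>R c" by auto
      let ?u = "c /\<^sub>R norm c"
      have "L *v ?u = lam i1 *\<^sub>R ?u" using c(2) by (simp add: matrix_vector_mult_scaleR)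
      then have "norm (L *v ?u) = lam i1" using c(1) lam(1)[of i1] by simp
      moreover have "norm ?u = 1" using c(1) by simp
      ultimately show ?thesis
        using norm_growth_bound[OF L r \<beta>(1) norm_bound, of ?u] by (simp add: lam_exp)
    qed
    moreover have "\<rho>bar * (cmod (lam0 imax))\<^sup>2 \<le> \<beta>"
    proof -
      let ?z = "lam0 imax" and ?A = "Jac f 0"
      have "?z \<in># eigenvalues ?A" by (simp add: assms(12))
      from eigenvalue_real_pair[OF this] obtain a b where ab: "a \<noteq> 0 \<or> b \<noteq> 0"
        "?A *v a = Re ?z *\<^sub>R a - Im ?z *\<^sub>R b" "?A *v b = Im ?z *\<^sub>R a + Re ?z *\<^sub>R b" by blast
      let ?c = "(norm a)\<^sup>2 + (norm b)\<^sup>2" and ?g = "\<rho>bar * (cmod ?z)\<^sup>2"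
      have c: "?c > 0" using ab(1) by (auto simp: add_pos_nonneg add_nonneg_pos)
      have "1 < cmod ?z" using assms(4) \<open>?z \<in># eigenvalues ?A\<close> by (simp add: unstable_plant_def)
      then have g: "?g > 0" using r by (intro mult_pos_pos) auto
      have "?g * ?g ^ n \<le> K * \<beta> ^ n" for n
      proof -
        have "?g ^ Suc n * ?c = \<rho>bar ^ Suc n * ((cmod ?z)\<^sup>2 ^ Suc n * ?c)" by (simp add: power_mult_distrib mult_ac)
        also have "\<dots> = \<rho>bar ^ Suc n * (norm (mat_power ?A (Suc n) *v a))\<^sup>2
            + \<rho>bar ^ Suc n * (norm (mat_power ?A (Suc n) *v b))\<^sup>2"
          unfolding cmod_power2 norm_eigenpair_growth[OF ab(2,3), symmetric] by (rule distrib_left)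
        also have "\<dots> \<le> K * \<beta> ^ n * (norm a)\<^sup>2 + K * \<beta> ^ n * (norm b)\<^sup>2"
          using norm_bound[of n 0] unfolding transition0 by (intro add_mono)
        also have "\<dots> = K * \<beta> ^ n * ?c" by (simp add: distrib_left)
        finally have "?g * ?g ^ n * ?c \<le> K * \<beta> ^ n * ?c" by (simp only: power_Suc)
        then show ?thesis using c by (rule mult_right_le_imp_le)
      qed
      then show ?thesis by (intro geometric_dominated_limit[OF tendsto_const \<beta>(1) _ g])
    qed
    ultimately show ?thesis using \<beta>(2) by (auto simp: max_def)
  qed
  show ?thesis using part1 part2 by auto
qed

end
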